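(* Let $\mathcal L:\sum_{i=1}^kc_ix_i=0$ be a homogeneous linear equation with $k\ge3$ and $c_1,\dots,c_k\in\mathbb Z\setminus\{0\}$, and assume there is no $I\subseteq[k]$ with $|I|\ge3$ and $\sum_{i\in I}c_i=0$. Then there exists $\varepsilon>0$ such that for every integer $t$ and every sufficiently large prime $p$ (depending on $t$ and $\mathcal L$), there is an $\mathcal L$-solution-free set $A\subseteq\mathbb F_p$ with $|A|\ge\varepsilon p$ and $\chi(\mathsf{Cay}(\mathbb F_p,A))\ge t$.
   Context: A set $A\subseteq\mathbb F_p$ is $\mathcal L$-solution-free if there is no $(x_1,\dots,x_k)\in A^k$ with pairwise distinct entries and $\sum_ic_ix_i=0$ in $\mathbb F_p$. $\mathsf{Cay}(\mathbb F_p,A)$ is the Cayley digraph with arc $u\to v$ iff $v-u\in A$; $\chi$ is the chromatic number of its underlying undirected graph. *)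

theory Defs
  imports Complex_Main "HOL-Computational_Algebra.Primes"
begin

text \<open>F_p is modelled as {0..<p} (residues mod p). The equation sum_{i<k} c i * x i = 0
  has coefficients indexed by {0..<k}.\<close>

definition solution_free :: "nat \<Rightarrow> (nat \<Rightarrow> int) \<Rightarrow> nat \<Rightarrow> nat set \<Rightarrow> bool" where
  "solution_free k c p A \<longleftrightarrow>
     \<not> (\<exists>x::nat \<Rightarrow> nat. (\<forall>i<k. x i \<in> A) \<and> inj_on x {0..<k} \<and>
          (\<Sum>i<k. c i * int (x i)) mod int p = 0)"

definition cay_adj :: "nat \<Rightarrow> nat set \<Rightarrow> nat \<Rightarrow> nat \<Rightarrow> bool" where
  "cay_adj p A u v \<longleftrightarrow> u \<noteq> v \<and>
     (nat ((int v - int u) mod int p) \<in> A \<or> nat ((int u - int v) mod int p) \<in> A)"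

definition proper_colouring :: "nat \<Rightarrow> nat set \<Rightarrow> nat \<Rightarrow> (nat \<Rightarrow> nat) \<Rightarrow> bool" where
  "proper_colouring p A m f \<longleftrightarrow>
     (\<forall>u<p. f u < m) \<and> (\<forall>u<p. \<forall>v<p. cay_adj p A u v \<longrightarrow> f u \<noteq> f v)"

definition cay_chromatic :: "nat \<Rightarrow> nat set \<Rightarrow> nat" where
  "cay_chromatic p A = (LEAST m. \<exists>f. proper_colouring p A m f)"

end

theory Submission
  imports Defs "HOL-Number_Theory.Cong"
begin

text \<open>
  Let \<open>\<sigma>\<close> be the (nonzero) sum of all coefficients, \<open>L\<close> the absolute value of their product and \<open>q\<close> a prime
  exceeding \<open>\<bar>\<sigma>\<bar>L\<close>. The set is \<open>A = B \<union> L T\<close>, where \<open>T\<close> is a finite set of integers independent of \<open>p\<close> that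
  forces the large chromatic number and \<open>B\<close> is a dense part of a short interval of integers around a
  small multiple of \<open>p\<close>, so that a solution modulo \<open>p\<close> is a solution in the integers. If the
  coefficients of the variables lying in \<open>B\<close> do not sum to zero, the size of the terms excludes the
  solution. Otherwise the hypothesis leaves at most two variables in \<open>B\<close>, with opposite coefficients,
  and \<open>b - b'\<close> is an integer combination of elements of \<open>T\<close> whose coefficient sum is a divisor of
  \<open>\<sigma> L\<close>, hence not divisible by \<open>q\<close>.

  The elements of \<open>T\<close> are the differences of integer codes of vectors \<open>u, v\<close> in \<open>(\<int>/q)^N\<close> such that
  \<open>v = u + (1,\<dots>,1)\<close> outside at most \<open>m\<close> coordinates. This directed analogue of a Kneser graph has chromatic
  number tending to infinity with \<open>m\<close>, by a Borsuk-Ulam argument for \<open>\<int>/q\<close>-actions. Each element of \<open>T\<close>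
  multiplies almost all terms of the exponential sum \<open>F(b) = \<Sum> exp(2\<pi>i b/Q^a)\<close>, \<open>1 \<le> a \<le> N\<close>, by nearly \<open>exp(2\<pi>i/q)\<close>,
  so a forbidden combination of elements of \<open>T\<close> rotates \<open>F\<close> by a nontrivial \<open>q\<close>-th root of unity up to
  a bounded error. As \<open>\<bar>F\<bar>\<close> is of order \<open>sqrt N\<close> on a positive proportion of the integers,
  restricting \<open>F / sqrt N\<close> to a small square away from the origin defines a set of density bounded below
  in terms of \<open>q\<close> alone that contains no two integers differing by such a combination.
\<close>

section \<open>Equivariant labellings of iterated joins\<close>

text \<open>Cochains of an ordered complex are represented as integer-valued functions on vertex lists; the
  complex is augmented, with the empty list as the simplex of dimension \<open>-1\<close>.\<close>

fun cobd :: "('a list \<Rightarrow> int) \<Rightarrow> 'a list \<Rightarrow> int" where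
  "cobd \<phi> [] = 0"
| "cobd \<phi> (x # xs) = \<phi> xs - cobd (\<lambda>ys. \<phi> (x # ys)) xs"

text \<open>Dual of the prism operator: the alternating evaluation on the lists x_0,...,x_i,J
  x_i,...,J x_n, a homotopy from the identity to \<open>J\<close>.\<close>

fun prism :: "('a \<Rightarrow> 'a) \<Rightarrow> ('a list \<Rightarrow> int) \<Rightarrow> 'a list \<Rightarrow> int" where
  "prism J \<phi> [] = 0"
| "prism J \<phi> (x # xs) = \<phi> (x # J x # map J xs) - prism J (\<lambda>ys. \<phi> (x # ys)) xs"

text \<open>Contracting homotopy: deform along \<open>J\<close>, then cone from
  \<open>p\<close>.\<close>

definition cone :: "'a \<Rightarrow> ('a \<Rightarrow> 'a) \<Rightarrow> ('a list \<Rightarrow> int) \<Rightarrow> 'a list \<Rightarrow> int" where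
  "cone p J \<phi> xs = \<phi> (p # map J xs) - prism J \<phi> xs"

text \<open>The differentials \<open>T - 1\<close> and \<open>1 + T + \<dots> + T^(q-1)\<close> of the periodic resolution of \<open>\<int>/q\<close>.\<close>

definition dop :: "('a \<Rightarrow> 'a) \<Rightarrow> nat \<Rightarrow> nat \<Rightarrow> ('a list \<Rightarrow> int) \<Rightarrow> 'a list \<Rightarrow> int" where
  "dop T q n \<phi> xs =
     (if even n then \<phi> (map T xs) - \<phi> xs else (\<Sum>h<q. \<phi> (map (T ^^ h) xs)))"

section \<open>Identities for the coboundary, the prism and the cone\<close>

lemma cobd_zero: "cobd (\<lambda>_. 0) xs = 0"
  by (induction xs) auto

lemma cobd_diff: "cobd (\<lambda>ys. \<phi> ys - \<psi> ys) xs = cobd \<phi> xs - cobd \<psi> xs"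
  by (induction xs arbitrary: \<phi> \<psi>) auto

lemma cobd_sum: "cobd (\<lambda>ys. \<Sum>h\<in>H. \<phi> h ys) xs = (\<Sum>h\<in>H. cobd (\<phi> h) xs)"
  by (induction xs arbitrary: \<phi>) (auto simp: sum_subtractf)

lemma cobd_map: "cobd (\<lambda>ys. \<phi> (map J ys)) xs = cobd \<phi> (map J xs)"
  by (induction xs arbitrary: \<phi>) auto

lemma cobd_cobd: "cobd (cobd \<phi>) xs = 0"
  by (induction xs arbitrary: \<phi>) (auto simp: cobd_diff)

lemma cobd_cong:
  assumes "\<And>ys. \<lbrakk>set ys \<subseteq> set xs; Suc (length ys) = length xs\<rbrakk> \<Longrightarrow> [\<phi> ys = \<psi> ys] (mod m)"
  shows "[cobd \<phi> xs = cobd \<psi> xs] (mod m)"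
  using assms
proof (induction xs arbitrary: \<phi> \<psi>)
  case (Cons x xs)
  have "[\<phi> xs = \<psi> xs] (mod m)"
    by (rule Cons.prems) auto
  moreover have "[cobd (\<lambda>ys. \<phi> (x # ys)) xs = cobd (\<lambda>ys. \<psi> (x # ys)) xs] (mod m)"
    by (rule Cons.IH, rule Cons.prems) auto
  ultimately show ?case
    by (auto intro: cong_diff)
qed simp

lemma cobd_adjacent:
  assumes "\<And>xs a ys. \<phi> (xs @ a # a # ys) = 0"
  shows "cobd \<phi> (xs @ a # a # ys) = 0"
  using assms
proof (induction xs arbitrary: \<phi>)
  case Nil
  have "(\<lambda>zs. \<phi> (a # a # zs)) = (\<lambda>_. 0)"
    using Nil[of "[]"] by auto
  then show ?case
    by (simp add: cobd_zero)
next
  case (Cons x xs)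
  have "cobd (\<lambda>zs. \<phi> (x # zs)) (xs @ a # a # ys) = 0"
    by (rule Cons.IH) (metis Cons.prems append_Cons)
  then show ?case
    using Cons.prems by simp
qed

lemma prism_diff: "prism J (\<lambda>ys. \<phi> ys - \<psi> ys) xs = prism J \<phi> xs - prism J \<psi> xs"
  by (induction xs arbitrary: \<phi> \<psi>) auto

lemma prism_homotopy:
  "prism J (cobd \<phi>) xs + cobd (prism J \<phi>) xs = \<phi> (map J xs) - \<phi> xs"
proof (induction xs arbitrary: \<phi>)
  case (Cons x xs)
  show ?case
    using Cons.IH[of "\<lambda>ys. \<phi> (x # ys)"]
    by (simp add: prism_diff cobd_diff cobd_map[where \<phi> = "\<lambda>ys. \<phi> (x # J x # ys)"])
qed simp

lemma cone_homotopy: "cone p J (cobd \<phi>) xs = \<phi> xs - cobd (cone p J \<phi>) xs"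
  using prism_homotopy[of J \<phi> xs]
  by (simp add: cone_def[abs_def] cobd_diff cobd_map[where \<phi> = "\<lambda>ys. \<phi> (p # ys)"])

lemma cone_diff: "cone p J (\<lambda>ys. \<phi> ys - \<psi> ys) xs = cone p J \<phi> xs - cone p J \<psi> xs"
  by (simp add: cone_def prism_diff)

lemma dop_diff: "dop T q n (\<lambda>ys. \<phi> ys - \<psi> ys) xs = dop T q n \<phi> xs - dop T q n \<psi> xs"
  by (simp add: dop_def sum_subtractf)

lemma dop_cobd: "dop T q n (cobd \<phi>) xs = cobd (dop T q n \<phi>) xs"
  by (simp add: dop_def[abs_def] cobd_diff cobd_sum cobd_map)

lemma sum_rotate:
  fixes f :: "nat \<Rightarrow> int"
  shows "f q = f 0 \<Longrightarrow> (\<Sum>h<q. f (Suc h)) = (\<Sum>h<q. f h)"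
  using sum.lessThan_Suc_shift[of f q] by simp

lemma dop_dop:
  assumes "T ^^ q = id"
  shows "dop T q n (dop T q (Suc n) \<phi>) xs = 0"
proof -
  have "(\<Sum>h<q. \<phi> (map (T ^^ h) (map T xs))) = (\<Sum>h<q. \<phi> (map (T ^^ Suc h) xs))"
    by (simp add: funpow_Suc_right del: funpow.simps)
  also have "\<dots> = (\<Sum>h<q. \<phi> (map (T ^^ h) xs))"
    by (rule sum_rotate[where f = "\<lambda>h. \<phi> (map (T ^^ h) xs)"]) (simp add: assms)
  finally have 1: "(\<Sum>h<q. \<phi> (map (T ^^ h) (map T xs))) = (\<Sum>h<q. \<phi> (map (T ^^ h) xs))" .
  have "(\<Sum>h<q. \<phi> (map T (map (T ^^ h) xs))) = (\<Sum>h<q. \<phi> (map (T ^^ Suc h) xs))"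
    by simp
  also have "\<dots> = (\<Sum>h<q. \<phi> (map (T ^^ h) xs))"
    by (rule sum_rotate[where f = "\<lambda>h. \<phi> (map (T ^^ h) xs)"]) (simp add: assms)
  finally have 2: "(\<Sum>h<q. \<phi> (map T (map (T ^^ h) xs))) = (\<Sum>h<q. \<phi> (map (T ^^ h) xs))" .
  show ?thesis
    using 1 2 by (simp add: dop_def sum_subtractf)
qed

text \<open>The identity outside 0,...,q-1, so that \<open>rot q ^^ q = id\<close> holds on all
  naturals and lifts to \<open>vrot\<close>.\<close>

definition rot :: "nat \<Rightarrow> nat \<Rightarrow> nat" where
  "rot q a = (if a < q then Suc a mod q else a)"

lemma rot_pow: "a < q \<Longrightarrow> (rot q ^^ h) a = (a + h) mod q"
  by (induction h) (auto simp: rot_def mod_Suc_eq)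

lemma rot_pow_id: "rot q ^^ q = id"
proof
  fix a
  have "a \<ge> q \<Longrightarrow> (rot q ^^ h) a = a" for h
    by (induction h) (auto simp: rot_def)
  then show "(rot q ^^ q) a = id a"
    by (cases "a < q") (auto simp: rot_pow)
qed

text \<open>An abstract form of the iterated join of copies of \<open>\<int>/q\<close>: the map \<open>J n\<close> joins a face with the vertex
  \<open>p (n + 1)\<close>, so that \<open>Lv n\<close> is contractible to a point inside \<open>Lv (n + 1)\<close>.\<close>

locale cyclic_tower =
  fixes T :: "'a \<Rightarrow> 'a" and q :: nat and le :: "'a \<Rightarrow> 'a \<Rightarrow> bool" and Lv :: "nat \<Rightarrow> 'a set"
    and p :: "nat \<Rightarrow> 'a" and J :: "nat \<Rightarrow> 'a \<Rightarrow> 'a"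
  assumes q_gt_1: "q > 1"
    and T_pow: "T ^^ q = id"
    and le_refl: "le x x"
    and le_trans: "le x y \<Longrightarrow> le y z \<Longrightarrow> le x z"
    and T_mono: "le x y \<Longrightarrow> le (T x) (T y)"
    and T_Lv: "x \<in> Lv n \<Longrightarrow> T x \<in> Lv n"
    and Lv_Suc: "Lv n \<subseteq> Lv (Suc n)"
    and p_Lv: "p n \<in> Lv n"
    and J_Lv: "x \<in> Lv n \<Longrightarrow> J n x \<in> Lv (Suc n)"
    and le_J: "x \<in> Lv n \<Longrightarrow> le x (J n x)"
    and p_le_J: "le (p (Suc n)) (J n x)"
    and J_mono: "le x y \<Longrightarrow> le (J n x) (J n y)"
begin

text \<open>Evaluation on an \<open>n\<close>-chain \<open>c n\<close>, the cone over the cycle obtained by applying a differential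
  of the periodic resolution to \<open>c (n - 1)\<close>; the boundary formula for \<open>c n\<close> is \<open>ev_cobd\<close> below.\<close>

primrec ev :: "nat \<Rightarrow> ('a list \<Rightarrow> int) \<Rightarrow> int" where
  "ev 0 \<phi> = \<phi> [p 0]"
| "ev (Suc n) \<phi> = ev n (dop T q n (cone (p (Suc n)) (J n) \<phi>))"

lemma ev_diff: "ev n (\<lambda>xs. \<phi> xs - \<psi> xs) = ev n \<phi> - ev n \<psi>"
proof (induction n arbitrary: \<phi> \<psi>)
  case (Suc n)
  then show ?case
    by (simp add: cone_diff[abs_def] dop_diff[abs_def])
qed simp

lemma ev_cobd: "ev n (cobd \<phi>) = (case n of 0 \<Rightarrow> \<phi> [] | Suc m \<Rightarrow> ev m (dop T q m \<phi>))"
proof (induction n arbitrary: \<phi>)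
  case (Suc n)
  let ?h = "cone (p (Suc n)) (J n) \<phi>"
  have z: "ev n (\<lambda>_. 0) = 0" for n
    using ev_diff[of n "\<lambda>_. 0" "\<lambda>_. 0"] by simp
  have "ev (Suc n) (cobd \<phi>) = ev n (dop T q n \<phi>) - ev n (cobd (dop T q n ?h))"
    by (simp add: cone_homotopy[abs_def] dop_diff[abs_def] ev_diff dop_cobd[abs_def])
  \<comment> \<open>The chain being coned is a cycle: in positive dimension because consecutive
    differentials compose to zero, in dimension 0 because T - 1 kills the augmentation.\<close>
  also have "ev n (cobd (dop T q n ?h)) = 0"
    unfolding Suc.IH by (auto split: nat.split simp: dop_dop[OF T_pow, abs_def] z, simp add: dop_def)
  finally show ?case by simp
qed simp

lemma T_pow_mono: "le x y \<Longrightarrow> le ((T ^^ h) x) ((T ^^ h) y)"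
  by (induction h) (auto intro: T_mono)

lemma T_pow_Lv: "x \<in> Lv n \<Longrightarrow> (T ^^ h) x \<in> Lv n"
  by (induction h) (auto intro: T_Lv)

text \<open>The prism over a chain of the order again consists of chains. That new entries lie above
  old ones is what allows the head to be put back in front during the induction.\<close>

lemma prism_cong:
  assumes "sorted_wrt le xs" "set xs \<subseteq> Lv n"
    and "\<And>ys. \<lbrakk>sorted_wrt le ys; set ys \<subseteq> Lv (Suc n); length ys = Suc (length xs);
           \<forall>y\<in>set ys. \<exists>x\<in>set xs. le x y\<rbrakk> \<Longrightarrow> [\<phi> ys = \<psi> ys] (mod m)"
  shows "[prism (J n) \<phi> xs = prism (J n) \<psi> xs] (mod m)"
  using assms
proof (induction xs arbitrary: \<phi> \<psi>)
  case (Cons x xs)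
  have "[\<phi> (x # J n x # map (J n) xs) = \<psi> (x # J n x # map (J n) xs)] (mod m)"
    using Cons.prems(1,2) Lv_Suc[of n]
    by (intro Cons.prems(3))
       (auto simp: sorted_wrt_map le_refl le_J intro: J_mono J_Lv le_trans[OF _ le_J]
         elim!: sorted_wrt_mono_rel[rotated])
  moreover have "[prism (J n) (\<lambda>ys. \<phi> (x # ys)) xs = prism (J n) (\<lambda>ys. \<psi> (x # ys)) xs] (mod m)"
  proof (rule Cons.IH)
    fix ys assume ys: "sorted_wrt le ys" "set ys \<subseteq> Lv (Suc n)" "length ys = Suc (length xs)"
      "\<forall>y\<in>set ys. \<exists>x\<in>set xs. le x y"
    have "\<forall>y\<in>set ys. le x y"
      using ys(4) Cons.prems(1) by (auto intro: le_trans)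
    then show "[\<phi> (x # ys) = \<psi> (x # ys)] (mod m)"
      using ys Cons.prems(1,2) Lv_Suc[of n] by (intro Cons.prems(3)) (auto simp: le_refl)
  qed (use Cons.prems in auto)
  ultimately show ?case
    by (auto intro: cong_diff)
qed simp

text \<open>Cones, prisms and powers of \<open>T\<close> preserve chains of the order, so the formal
  chain behind \<open>ev n\<close> is supported on actual faces.\<close>

lemma ev_cong:
  assumes "\<And>xs. \<lbrakk>sorted_wrt le xs; set xs \<subseteq> Lv n; length xs = Suc n\<rbrakk> \<Longrightarrow> [\<phi> xs = \<psi> xs] (mod m)"
  shows "[ev n \<phi> = ev n \<psi>] (mod m)"
  using assms
proof (induction n arbitrary: \<phi> \<psi>)
  case 0
  then show ?case using p_Lv[of 0] by simp
next
  case (Suc n)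
  let ?h = "cone (p (Suc n)) (J n)"
  have c: "[?h \<phi> xs = ?h \<psi> xs] (mod m)"
    if xs: "sorted_wrt le xs" "set xs \<subseteq> Lv n" "length xs = Suc n" for xs
  proof -
    have "[\<phi> (p (Suc n) # map (J n) xs) = \<psi> (p (Suc n) # map (J n) xs)] (mod m)"
      using xs p_Lv by (intro Suc.prems)
        (auto simp: sorted_wrt_map p_le_J intro: J_Lv J_mono elim!: sorted_wrt_mono_rel[rotated])
    moreover have "[prism (J n) \<phi> xs = prism (J n) \<psi> xs] (mod m)"
      using xs by (intro prism_cong Suc.prems) auto
    ultimately show ?thesis
      unfolding cone_def by (rule cong_diff)
  qed
  have t: "sorted_wrt le (map (T ^^ h) xs) \<and> set (map (T ^^ h) xs) \<subseteq> Lv n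
      \<and> length (map (T ^^ h) xs) = Suc n"
    if "sorted_wrt le xs" "set xs \<subseteq> Lv n" "length xs = Suc n" for xs h
    using that by (auto simp: sorted_wrt_map intro: T_pow_Lv T_pow_mono elim!: sorted_wrt_mono_rel[rotated])
  have "[dop T q n (?h \<phi>) xs = dop T q n (?h \<psi>) xs] (mod m)"
    if xs: "sorted_wrt le xs" "set xs \<subseteq> Lv n" "length xs = Suc n" for xs
    using t[OF xs, of 1] t[OF xs] xs c by (auto simp: dop_def intro!: cong_diff cong_sum)
  then show ?case
    by (auto intro: Suc.IH)
qed

end

section \<open>The periodic resolution on label lists and a Tucker-type lemma\<close>

definition normalized :: "('a list \<Rightarrow> int) \<Rightarrow> bool" where
  "normalized \<phi> \<longleftrightarrow> (\<forall>xs a ys. \<phi> (xs @ a # a # ys) = 0)"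

text \<open>Nonempty label lists form a free Z/q-set, since the heads of the rotates of a list run
  once through all residues; hence, modulo q, the kernel of one differential is the image of the
  other.\<close>

lemma dop_solve:
  assumes "normalized u"
    and "\<And>xs. \<lbrakk>set xs \<subseteq> {..<q}; length xs = Suc n\<rbrakk> \<Longrightarrow> [dop (rot q) q (Suc n) u xs = 0] (mod int q)"
  shows "\<exists>z. normalized z \<and>
    (\<forall>xs. set xs \<subseteq> {..<q} \<longrightarrow> length xs = Suc n \<longrightarrow> [dop (rot q) q n z xs = u xs] (mod int q))"
proof (cases "even n")
  case True
  \<comment> \<open>Sums \<open>u\<close> over the rotates of \<open>xs\<close> with heads 0,...,hd
    xs - 1, so that one rotation adds \<open>u xs\<close>; the summand \<open>q\<close> keeps the
    subtraction from truncating.\<close>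
  define z where "z xs = (\<Sum>h<hd xs. u (map (rot q ^^ (h + q - hd xs)) xs))" for xs
  have "normalized z"
    using assms(1) unfolding normalized_def z_def by auto
  moreover have "[dop (rot q) q n z xs = u xs] (mod int q)"
    if xs: "set xs \<subseteq> {..<q}" "length xs = Suc n" for xs
  proof -
    obtain a as where a: "xs = a # as" "a < q"
      using xs by (cases xs) auto
    show ?thesis
    proof (cases "Suc a < q")
      case less: True
      have "z (map (rot q) xs) = (\<Sum>h<Suc a. u (map (rot q ^^ (h + q - Suc a)) (map (rot q) xs)))"
        using less a by (simp add: z_def rot_def)
      also have "\<dots> = (\<Sum>h<Suc a. u (map (rot q ^^ (h + q - a)) xs))"
      proof (rule sum.cong)
        fix h
        have "h + q - a = Suc (h + q - Suc a)" using less by simp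
        then show "u (map (rot q ^^ (h + q - Suc a)) (map (rot q) xs)) = u (map (rot q ^^ (h + q - a)) xs)"
          by (simp add: funpow_Suc_right del: funpow.simps)
      qed simp
      also have "\<dots> = z xs + u xs"
        using a by (simp add: z_def rot_pow_id)
      finally show ?thesis
        using True by (simp add: dop_def)
    next
      \<comment> \<open>The head q - 1 wraps around to 0; the full orbit sum needed to compensate
        vanishes modulo q by hypothesis.\<close>
      case False
      then have q: "q = Suc a" using a by simp
      have "z (map (rot q) xs) = 0"
        using q a by (simp add: z_def rot_def)
      moreover have "u xs + z xs = (\<Sum>h<q. u (map (rot q ^^ h) xs))"
        unfolding q sum.lessThan_Suc_shift using a q by (simp add: z_def funpow_Suc_right del: funpow.simps(2))
      moreover have "[(\<Sum>h<q. u (map (rot q ^^ h) xs)) = 0] (mod int q)"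
        using assms(2)[OF xs] True by (simp add: dop_def)
      ultimately have "[u xs + z xs = 0] (mod int q)" by simp
      then have "[- z xs = u xs] (mod int q)"
        by (simp add: cong_iff_dvd_diff) (metis add.commute dvd_minus_iff minus_add_distrib uminus_add_conv_diff)
      then show ?thesis
        using True \<open>z (map (rot q) xs) = 0\<close> by (simp add: dop_def)
    qed
  qed
  ultimately show ?thesis by blast
next
  case False
  \<comment> \<open>Keeps one list of each orbit; as \<open>u\<close> is invariant modulo q, the
    orbit sum of \<open>z\<close> is \<open>u\<close>.\<close>
  define z where "z xs = (if hd xs = 0 then u xs else 0)" for xs
  have "normalized z"
    using assms(1) unfolding normalized_def z_def by auto
  moreover have "[dop (rot q) q n z xs = u xs] (mod int q)"
    if xs: "set xs \<subseteq> {..<q}" "length xs = Suc n" for xs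
  proof -
    obtain a as where a: "xs = a # as" "a < q"
      using xs by (cases xs) auto
    have inv: "[u (map (rot q ^^ h) xs) = u xs] (mod int q)" for h
    proof (induction h)
      case (Suc h)
      have "set (map (rot q ^^ h) xs) \<subseteq> {..<q}"
        using xs by (auto simp: rot_pow subset_iff)
      then have "[u (map (rot q) (map (rot q ^^ h) xs)) - u (map (rot q ^^ h) xs) = 0] (mod int q)"
        using assms(2)[of "map (rot q ^^ h) xs"] xs False by (simp add: dop_def)
      then have "[u (map (rot q ^^ Suc h) xs) = u (map (rot q ^^ h) xs)] (mod int q)"
        by (simp add: cong_diff_iff_cong_0)
      then show ?case using Suc cong_trans by blast
    qed simp
    define h0 where "h0 = (q - a) mod q"
    have h0: "h0 < q" using a by (simp add: h0_def)
    have hd: "hd (map (rot q ^^ h) xs) = 0 \<longleftrightarrow> h = h0" if "h < q" for h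
    proof -
      have "hd (map (rot q ^^ h) xs) = (a + h) mod q"
        using a by (simp add: rot_pow)
      also have "\<dots> = 0 \<longleftrightarrow> h = h0"
        using that a by (cases "a = 0"; cases "a + h < q") (auto simp: h0_def mod_if)
      finally show ?thesis .
    qed
    have "(\<Sum>h<q. z (map (rot q ^^ h) xs)) = (\<Sum>h<q. if h = h0 then u (map (rot q ^^ h) xs) else 0)"
      using hd by (intro sum.cong) (auto simp: z_def)
    also have "\<dots> = u (map (rot q ^^ h0) xs)"
      using h0 by simp
    finally show ?thesis
      using False inv[of h0] by (simp add: dop_def)
  qed
  ultimately show ?thesis by blast
qed

context cyclic_tower
begin

text \<open>Pulling back cochains on label lists along an equivariant labelling, one finds in every dimension
  a cochain whose value on the chain underlying \<open>ev n\<close> is \<open>1\<close> modulo \<open>q\<close>: if \<open>u\<close> is such a cochain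
  and \<open>D z = u\<close> for the differential \<open>D\<close> of the resolution, then the coboundary of \<open>z\<close> is the next one.\<close>

lemma label_cochain:
  assumes "\<And>n x. x \<in> Lv n \<Longrightarrow> lab x < q \<and> lab (T x) = rot q (lab x)"
  shows "\<exists>u. normalized u \<and>
    (\<forall>xs. set xs \<subseteq> {..<q} \<longrightarrow> length xs = Suc n \<longrightarrow> [dop (rot q) q (Suc n) u xs = 0] (mod int q)) \<and>
    (\<forall>xs. set xs \<subseteq> {..<q} \<longrightarrow> length xs = Suc (Suc n) \<longrightarrow> [cobd u xs = 0] (mod int q)) \<and>
    [ev n (\<lambda>xs. u (map lab xs)) = 1] (mod int q)"
proof (induction n)
  case 0
  \<comment> \<open>Its sum over an orbit is q, hence 0 modulo q.\<close>
  define u :: "nat list \<Rightarrow> int" where "u xs = (if length xs = 1 then 1 else 0)" for xs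
  have "normalized u" by (auto simp: normalized_def u_def)
  moreover have "[dop (rot q) q 1 u xs = 0] (mod int q)" if "length xs = 1" for xs
    using that by (simp add: dop_def u_def cong_0_iff)
  moreover have "cobd u xs = 0" if "length xs = 2" for xs
    using that by (auto simp: u_def numeral_2_eq_2 length_Suc_conv)
  ultimately show ?case
    by (intro exI[of _ u]) (auto simp: numeral_2_eq_2, simp add: u_def)
next
  case (Suc n)
  then obtain u where u: "normalized u"
    "\<And>xs. \<lbrakk>set xs \<subseteq> {..<q}; length xs = Suc n\<rbrakk> \<Longrightarrow> [dop (rot q) q (Suc n) u xs = 0] (mod int q)"
    "\<And>xs. \<lbrakk>set xs \<subseteq> {..<q}; length xs = Suc (Suc n)\<rbrakk> \<Longrightarrow> [cobd u xs = 0] (mod int q)"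
    "[ev n (\<lambda>xs. u (map lab xs)) = 1] (mod int q)"
    by blast
  obtain z where z: "normalized z"
    "\<And>xs. \<lbrakk>set xs \<subseteq> {..<q}; length xs = Suc n\<rbrakk> \<Longrightarrow> [dop (rot q) q n z xs = u xs] (mod int q)"
    using dop_solve[OF u(1,2)] by blast
  have "normalized (cobd z)"
    using z(1) cobd_adjacent[of z] by (auto simp: normalized_def)
  moreover have "[dop (rot q) q (Suc (Suc n)) (cobd z) xs = 0] (mod int q)"
    if xs: "set xs \<subseteq> {..<q}" "length xs = Suc (Suc n)" for xs
  proof -
    \<comment> \<open>The differential depends only on the parity of its index, so it commutes past
      the coboundary and acts on \<open>z\<close> to give \<open>u\<close>.\<close>
    have "dop (rot q) q (Suc (Suc n)) (cobd z) xs = cobd (dop (rot q) q n z) xs"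
      by (subst dop_cobd) (simp add: dop_def[abs_def])
    also have "[\<dots> = cobd u xs] (mod int q)"
      using xs by (intro cobd_cong z(2)) auto
    also have "[cobd u xs = 0] (mod int q)"
      using xs by (rule u(3))
    finally show ?thesis .
  qed
  moreover have "[ev (Suc n) (\<lambda>xs. cobd z (map lab xs)) = 1] (mod int q)"
  proof -
    have "ev (Suc n) (\<lambda>xs. cobd z (map lab xs)) = ev (Suc n) (cobd (\<lambda>xs. z (map lab xs)))"
    proof -
      have "cobd (\<lambda>xs. z (map lab xs)) xs = cobd z (map lab xs)" for xs :: "'a list"
        by (induction xs arbitrary: z) auto
      then show ?thesis by presburger
    qed
    also have "\<dots> = ev n (dop T q n (\<lambda>xs. z (map lab xs)))"
      by (subst ev_cobd) simp
    also have "[\<dots> = ev n (\<lambda>xs. u (map lab xs))] (mod int q)"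
    proof (rule ev_cong)
      fix xs assume xs: "set xs \<subseteq> Lv n" "length xs = Suc n"
      have "lab ((T ^^ h) x) = (rot q ^^ h) (lab x)" if "x \<in> Lv n" for h x
      proof (induction h)
        case (Suc h)
        then show ?case
          using assms[of "(T ^^ h) x" n] T_pow_Lv[OF that] by simp
      qed simp
      then have lp: "map (lab \<circ> (T ^^ h)) xs = map ((rot q ^^ h) \<circ> lab) xs" for h
        using xs by auto
      have "dop T q n (\<lambda>xs. z (map lab xs)) xs = dop (rot q) q n z (map lab xs)"
        by (simp add: dop_def lp lp[of "Suc 0", unfolded funpow.simps o_id])
      also have "[\<dots> = u (map lab xs)] (mod int q)"
        using xs assms by (intro z(2)) auto
      finally show "[dop T q n (\<lambda>xs. z (map lab xs)) xs = u (map lab xs)] (mod int q)" .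
    qed
    also note u(4)
    finally show ?thesis .
  qed
  ultimately show ?case
    by (intro exI[of _ "cobd z"]) (auto simp: cobd_cobd)
qed

text \<open>If every chain had two equal consecutive labels, the normalized cochain of
  \<open>label_cochain\<close> would vanish on all of them, against its evaluation 1 modulo q. This
  is a combinatorial Borsuk-Ulam theorem in the manner of Tucker's lemma.\<close>

lemma alternating_chain:
  assumes "\<And>n x. x \<in> Lv n \<Longrightarrow> lab x < q \<and> lab (T x) = rot q (lab x)"
  shows "\<exists>xs. sorted_wrt le xs \<and> set xs \<subseteq> Lv n \<and> length xs = Suc n \<and>
    (\<forall>i<n. lab (xs ! i) \<noteq> lab (xs ! Suc i))"
proof (rule ccontr)
  assume neg: "\<not> ?thesis"
  obtain u where u: "normalized u" "[ev n (\<lambda>xs. u (map lab xs)) = 1] (mod int q)"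
    using label_cochain[of lab n] assms by blast
  have "u (map lab xs) = 0"
    if xs: "sorted_wrt le xs" "set xs \<subseteq> Lv n" "length xs = Suc n" for xs
  proof -
    obtain i where i: "i < n" "lab (xs ! i) = lab (xs ! Suc i)"
      using neg xs by blast
    let ?ys = "map lab xs"
    have "?ys = take i ?ys @ ?ys ! i # ?ys ! Suc i # drop (Suc (Suc i)) ?ys"
      using i xs by (metis Cons_nth_drop_Suc Suc_less_eq append_take_drop_id length_map less_SucI)
    also have "?ys ! i = ?ys ! Suc i"
      using i xs by simp
    finally show ?thesis
      using u(1) unfolding normalized_def by metis
  qed
  then have "[ev n (\<lambda>xs. u (map lab xs)) = ev n (\<lambda>_. 0)] (mod int q)"
    by (intro ev_cong) simp
  moreover have "ev n (\<lambda>_. 0) = 0"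
    using ev_diff[of n "\<lambda>_. 0" "\<lambda>_. 0"] by simp
  ultimately have "[0 = 1] (mod int q)"
    using u(2) by (metis cong_sym cong_trans)
  then show False
    using q_gt_1 by (simp add: cong_def)
qed

end

section \<open>A directed Kneser-type graph\<close>

text \<open>For prime q, a Z/q-action without fixed points is free, since every d with 0 < d < q is
  invertible modulo q. The label is the distance from a chosen point of the orbit.\<close>

lemma free_orbit_label:
  fixes R :: "'b \<Rightarrow> 'b"
  assumes q: "prime q"
    and S: "\<And>x. x \<in> S \<Longrightarrow> R x \<in> S" "\<And>x. x \<in> S \<Longrightarrow> (R ^^ q) x = x"
      "\<And>x. x \<in> S \<Longrightarrow> R x \<noteq> x"
  shows "\<exists>s. \<forall>x\<in>S. s x < q \<and> s (R x) = rot q (s x)"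
proof -
  have q0: "q > 0" using q prime_gt_0_nat by blast
  define orb where "orb x = range (\<lambda>i. (R ^^ i) x)" for x
  \<comment> \<open>Chosen from the orbit as a set, hence constant along it.\<close>
  define rep where "rep x = (SOME y. y \<in> orb x)" for x
  define s where "s x = (LEAST j. (R ^^ j) (rep x) = x)" for x
  have RS: "(R ^^ i) x \<in> S" if "x \<in> S" for i x
    using that by (induction i) (auto intro: S)
  have per: "(R ^^ (k * q)) x = x" if "x \<in> S" for k x
    using that by (induction k) (auto simp: funpow_add S(2))
  have md: "(R ^^ i) x = (R ^^ (i mod q)) x" if "x \<in> S" for i x
  proof -
    have "(R ^^ i) x = (R ^^ (i mod q + i div q * q)) x" by simp
    also have "\<dots> = (R ^^ (i mod q)) x"
      unfolding funpow_add using per[OF that] by simp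
    finally show ?thesis .
  qed
  have free: "(R ^^ d) x \<noteq> x" if "x \<in> S" "0 < d" "d < q" for x d
  proof
    assume eq: "(R ^^ d) x = x"
    have "coprime d q"
      using that q by (metis coprime_commute nat_dvd_not_less prime_imp_coprime_nat)
    then obtain e where "[d * e = Suc 0] (mod q)"
      using cong_solve_coprime_nat by blast
    moreover have "(R ^^ (d * e)) x = x"
      by (induction e) (auto simp: funpow_add eq)
    ultimately have "(R ^^ (Suc 0 mod q)) x = x"
      using md[OF that(1)] by (metis cong_def)
    then show False
      using S(3)[OF that(1)] prime_gt_1_nat[OF q] by simp
  qed
  have uniq: "i = j" if "x \<in> S" "i < q" "j < q" "(R ^^ i) x = (R ^^ j) x" for x i j
    using that(2-4)
  proof (induction i j rule: linorder_wlog)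
    case (le i j)
    have "(R ^^ (j - i)) ((R ^^ i) x) = (R ^^ i) x"
      using le by (metis comp_apply funpow_add le_add_diff_inverse2)
    then show ?case
      using free[OF RS[OF that(1)], of "j - i" i] le by force
  qed auto
  have "s x < q \<and> s (R x) = rot q (s x)" if x: "x \<in> S" for x
  proof -
    have "orb (R x) = orb x"
    proof
      show "orb (R x) \<subseteq> orb x"
        by (auto simp: orb_def funpow_swap1 intro: range_eqI[of _ _ "Suc _"])
      have "(R ^^ i) x = (R ^^ (i + (q - 1))) (R x)" for i
      proof -
        have "(R ^^ (i + (q - 1))) (R x) = (R ^^ (i + q)) x"
          using q0 by (cases q) (auto simp: funpow_swap1)
        then show ?thesis
          using S(2)[OF x] by (simp add: funpow_add)
      qed
      then show "orb x \<subseteq> orb (R x)"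
        by (auto simp: orb_def)
    qed
    then have rR: "rep (R x) = rep x"
      by (simp add: rep_def)
    have "rep x \<in> orb x"
      unfolding rep_def by (rule someI[of _ x]) (auto simp: orb_def intro: range_eqI[of _ _ 0])
    then obtain i where i: "rep x = (R ^^ i) x"
      by (auto simp: orb_def)
    then have rS: "rep x \<in> S"
      using RS x by simp
    have "(R ^^ ((q - i mod q) mod q)) (rep x) = x"
    proof -
      have "i mod q \<le> q" using q0 by (simp add: less_imp_le)
      have "(R ^^ ((q - i mod q) mod q)) (rep x) = (R ^^ (q - i mod q)) ((R ^^ (i mod q)) x)"
        using md[OF rS] md[OF x] i by metis
      also have "\<dots> = x"
        using S(2)[OF x] \<open>i mod q \<le> q\<close> by (metis comp_apply funpow_add le_add_diff_inverse2)
      finally show ?thesis .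
    qed
    then have s1: "(R ^^ s x) (rep x) = x" "s x \<le> (q - i mod q) mod q"
      unfolding s_def by (rule LeastI, rule Least_le)
    then have s2: "s x < q"
      using q0 by (meson le_less_trans mod_less_divisor)
    have e: "(R ^^ rot q (s x)) (rep x) = R x"
    proof -
      have "(R ^^ rot q (s x)) (rep x) = (R ^^ Suc (s x)) (rep x)"
        using s2 md[OF rS] by (metis rot_def)
      then show ?thesis using s1 by simp
    qed
    have r: "rot q (s x) < q"
      using s2 by (simp add: rot_def)
    have "s (R x) = rot q (s x)"
      unfolding s_def[of "R x"] rR
    proof (rule Least_equality)
      show "(R ^^ rot q (s x)) (rep x) = R x"
        by (fact e)
    next
      fix j assume j: "(R ^^ j) (rep x) = R x"
      then have "(R ^^ (j mod q)) (rep x) = (R ^^ rot q (s x)) (rep x)"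
        using md[OF rS] e by metis
      then have "j mod q = rot q (s x)"
        using uniq[OF rS, of "j mod q"] r q0 by simp
      then show "rot q (s x) \<le> j"
        by (metis mod_less_eq_dividend)
    qed
    with s2 show ?thesis by simp
  qed
  then show ?thesis by blast
qed

text \<open>Nonempty partial vectors, ordered by extension, are the faces of the join of copies of \<open>\<int>/q\<close>.\<close>

definition vrot :: "nat \<Rightarrow> (nat \<rightharpoonup> nat) \<Rightarrow> (nat \<rightharpoonup> nat)" where
  "vrot q X = (\<lambda>a. map_option (rot q) (X a))"

definition partial_vecs :: "nat \<Rightarrow> nat \<Rightarrow> (nat \<rightharpoonup> nat) set" where
  "partial_vecs q n = {X. X \<noteq> Map.empty \<and> dom X \<subseteq> {..n} \<and> ran X \<subseteq> {..<q}}"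

definition total_vecs :: "nat \<Rightarrow> nat \<Rightarrow> (nat \<rightharpoonup> nat) set" where
  "total_vecs q N = {X. dom X = {..<N} \<and> ran X \<subseteq> {..<q}}"

lemma rot_less: "a < q \<Longrightarrow> rot q a < q"
  by (auto simp: rot_def)

lemma vrot_pow: "(vrot q ^^ h) X a = map_option (rot q ^^ h) (X a)"
proof (induction h)
  case (Suc h)
  then show ?case
    by (cases "X a") (simp_all add: vrot_def[of q "(vrot q ^^ h) X"])
qed (cases "X a"; simp)

lemma vrot_pow_id: "vrot q ^^ q = id"
  by (auto simp: fun_eq_iff vrot_pow rot_pow_id option.map_id)

lemma dom_vrot [simp]: "dom (vrot q X) = dom X"
  by (auto simp: vrot_def dom_def)

lemma vrot_partial_vecs: "X \<in> partial_vecs q n \<Longrightarrow> vrot q X \<in> partial_vecs q n"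
  unfolding partial_vecs_def
  by (auto simp: vrot_def ran_def fun_eq_iff dom_def intro!: rot_less)

lemma map_le_iff: "X \<subseteq>\<^sub>m Y \<longleftrightarrow> (\<forall>a y. X a = Some y \<longrightarrow> Y a = Some y)"
  by (force simp: map_le_def dom_def)

lemma vrot_mono: "X \<subseteq>\<^sub>m Y \<Longrightarrow> vrot q X \<subseteq>\<^sub>m vrot q Y"
  by (auto simp: map_le_iff vrot_def)

text \<open>Setting the new coordinate to 0 produces a face above both \<open>X\<close> and the new
  vertex, which contracts each level inside the next.\<close>

lemma cyclic_tower_vecs:
  assumes "q > 1"
  shows "cyclic_tower (vrot q) q map_le (partial_vecs q) (\<lambda>n. [n \<mapsto> 0]) (\<lambda>n X. X(Suc n \<mapsto> 0))"
proof
  show "[n \<mapsto> 0] \<in> partial_vecs q n" for n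
    using assms by (auto simp: partial_vecs_def)
  show "X(Suc n \<mapsto> 0) \<in> partial_vecs q (Suc n)" if "X \<in> partial_vecs q n" for X n
    using that assms by (auto simp: partial_vecs_def ran_def split: if_splits)
  show "X \<subseteq>\<^sub>m X(Suc n \<mapsto> 0)" if "X \<in> partial_vecs q n" for X n
    using that by (force simp: partial_vecs_def map_le_iff dom_def)
  show "partial_vecs q n \<subseteq> partial_vecs q (Suc n)" for n
    by (auto simp: partial_vecs_def)
  show "[Suc n \<mapsto> 0] \<subseteq>\<^sub>m X(Suc n \<mapsto> 0)" for X :: "nat \<rightharpoonup> nat" and n
    by (auto simp: map_le_iff)
  show "X(Suc n \<mapsto> 0) \<subseteq>\<^sub>m Y(Suc n \<mapsto> 0)" if "X \<subseteq>\<^sub>m Y" for X Y :: "nat \<rightharpoonup> nat" and n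
    using that by (auto simp: map_le_iff)
qed (use assms in \<open>auto simp: vrot_partial_vecs vrot_mono vrot_pow_id intro: map_le_trans\<close>)

text \<open>A partial vector missing at most \<open>m\<close> coordinates is labelled through the cyclic sequence of colour sets
  of the completions of its rotates. These sets shrink along a chain, and consecutive labels
  differ only if one of them shrinks strictly, which can happen at most \<open>q t\<close> times.\<close>

lemma shifted_kneser:
  fixes f :: "(nat \<rightharpoonup> nat) \<Rightarrow> nat"
  assumes q: "prime q" and m: "q * t < m" "m < N"
    and f: "\<And>Y. Y \<in> total_vecs q N \<Longrightarrow> f Y < t"
  shows "\<exists>Y\<in>total_vecs q N. \<exists>Y'\<in>total_vecs q N. card {a\<in>{..<N}. Y' a \<noteq> vrot q Y a} \<le> m \<and> f Y = f Y'"
proof (rule ccontr)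
  assume neg: "\<not> ?thesis"
  obtain n where N: "N = Suc n" using m by (cases N) auto
  have q1: "q > 1" using q prime_gt_1_nat by blast
  interpret cyclic_tower "vrot q" q map_le "partial_vecs q" "\<lambda>n. [n \<mapsto> 0]" "\<lambda>n X. X(Suc n \<mapsto> 0)"
    by (rule cyclic_tower_vecs[OF q1])
  define C where "C X = f ` {Y \<in> total_vecs q N. X \<subseteq>\<^sub>m Y}" for X
  define lg where "lg = {X \<in> partial_vecs q n. card (dom X) \<ge> N - m}"
  define \<tau> where "\<tau> X = (\<lambda>j. C ((vrot q ^^ j) X))" for X
  have fin: "finite (C X)" "C X \<subseteq> {..<t}" for X
    using f by (auto simp: C_def intro: finite_subset[of _ "{..<t}"])
  have anti: "C Y \<subseteq> C X" if "X \<subseteq>\<^sub>m Y" for X Y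
    using that by (auto simp: C_def intro: map_le_trans)
  have ne: "C X \<noteq> {}" if X: "X \<in> partial_vecs q n" for X
  proof -
    let ?Y = "\<lambda>a. if a \<in> dom X then X a else if a < N then Some 0 else None"
    have "?Y \<in> total_vecs q N"
      using X q1 by (auto simp: total_vecs_def partial_vecs_def N ran_def less_Suc_eq_le subset_iff
          split: if_splits)
    moreover have "X \<subseteq>\<^sub>m ?Y"
      by (auto simp: map_le_def)
    ultimately show ?thesis by (auto simp: C_def)
  qed
  \<comment> \<open>Completions of \<open>X\<close> and of its rotate correspond under rotation on
    \<open>dom X\<close>, hence outside at most m coordinates, so by \<open>neg\<close> they share
    no colour.\<close>
  have disj: "C X \<inter> C (vrot q X) = {}" if X: "X \<in> lg" for X
  proof (rule ccontr)
    assume "C X \<inter> C (vrot q X) \<noteq> {}"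
    then obtain Y Y' where Y: "Y \<in> total_vecs q N" "X \<subseteq>\<^sub>m Y" "Y' \<in> total_vecs q N"
      "vrot q X \<subseteq>\<^sub>m Y'" "f Y = f Y'"
      by (auto simp: C_def)
    have "Y' a = vrot q Y a" if "a \<in> dom X" for a
      using that Y(2,4) by (auto simp: map_le_iff vrot_def)
    then have "{a\<in>{..<N}. Y' a \<noteq> vrot q Y a} \<subseteq> {..<N} - dom X"
      by blast
    then have "card {a\<in>{..<N}. Y' a \<noteq> vrot q Y a} \<le> card ({..<N} - dom X)"
      by (intro card_mono) auto
    also have "\<dots> = N - card (dom X)"
    proof -
      have "dom X \<subseteq> {..<N}"
        using X by (auto simp: lg_def partial_vecs_def N)
      then show ?thesis
        by (metis card_Diff_subset card_lessThan finite_lessThan finite_subset)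
    qed
    also have "\<dots> \<le> m"
      using X by (auto simp: lg_def)
    finally show False
      using neg Y by blast
  qed
  have lg_vrot: "vrot q X \<in> lg" if "X \<in> lg" for X
    using that by (auto simp: lg_def vrot_partial_vecs)
  have lg_pow: "(vrot q ^^ j) X \<in> lg" if "X \<in> lg" for X j
    using that by (induction j) (auto simp: lg_vrot)
  \<comment> \<open>Period q and distinct neighbours: the shift \<open>R\<close> has no fixed point
    on such sequences, so they can be labelled equivariantly.\<close>
  define S where "S = {\<theta> :: nat \<Rightarrow> nat set. (\<forall>j. \<theta> (j + q) = \<theta> j) \<and> (\<forall>j. \<theta> (Suc j) \<noteq> \<theta> j)}"
  define R where "R = (\<lambda>\<theta> :: nat \<Rightarrow> nat set. \<theta> \<circ> Suc)"
  have R_pow: "(R ^^ i) \<theta> = (\<lambda>j. \<theta> (j + i))" for i \<theta>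
    by (induction i) (auto simp: R_def)
  have "\<exists>s. \<forall>\<theta>\<in>S. s \<theta> < q \<and> s (R \<theta>) = rot q (s \<theta>)"
  proof (rule free_orbit_label[OF q])
    fix \<theta> assume "\<theta> \<in> S"
    then have \<theta>: "\<theta> (j + q) = \<theta> j" "\<theta> (Suc j) \<noteq> \<theta> j" for j
      by (auto simp: S_def)
    show "R \<theta> \<in> S"
      using \<theta>(1)[of "Suc _"] \<theta>(2) by (auto simp: S_def R_def)
    show "(R ^^ q) \<theta> = \<theta>"
      using \<theta>(1) by (simp add: R_pow)
    show "R \<theta> \<noteq> \<theta>"
      using \<theta>(2) by (auto simp: R_def fun_eq_iff)
  qed
  then obtain s where s: "\<And>\<theta>. \<theta> \<in> S \<Longrightarrow> s \<theta> < q \<and> s (R \<theta>) = rot q (s \<theta>)"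
    by blast
  have \<tau>S: "\<tau> X \<in> S" if X: "X \<in> lg" for X
  proof -
    have "C ((vrot q ^^ Suc j) X) \<noteq> C ((vrot q ^^ j) X)" for j
    proof -
      have "C ((vrot q ^^ j) X) \<noteq> {}"
        using lg_pow[OF X] by (intro ne) (auto simp: lg_def)
      then show ?thesis
        using disj[OF lg_pow[OF X], of j] by auto
    qed
    then show ?thesis
      by (auto simp: S_def \<tau>_def funpow_add vrot_pow_id)
  qed
  have \<tau>R: "\<tau> (vrot q X) = R (\<tau> X)" for X
    by (auto simp: \<tau>_def R_def fun_eq_iff funpow_swap1)
  \<comment> \<open>Small vectors use the value at their least coordinate, which also turns with
    \<open>vrot\<close>; \<open>lg\<close> and its complement are closed under rotation, so an orbit
    never mixes the cases.\<close>
  define lab where "lab X = (if X \<in> lg then s (\<tau> X) else the (X (Min (dom X))))" for X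
  have lab: "lab X < q \<and> lab (vrot q X) = rot q (lab X)" if X: "X \<in> partial_vecs q n'" for X n'
  proof (cases "X \<in> lg")
    case True
    then show ?thesis
      using s[OF \<tau>S[OF True]] by (simp add: lab_def lg_vrot \<tau>R)
  next
    case False
    have "vrot q X \<notin> lg"
    proof
      assume "vrot q X \<in> lg"
      then have "(vrot q ^^ (q - 1)) (vrot q X) \<in> lg"
        by (rule lg_pow)
      also have "(vrot q ^^ (q - 1)) (vrot q X) = (vrot q ^^ q) X"
        using q1 by (cases q) (auto simp: funpow_swap1)
      finally show False
        using False by (simp add: vrot_pow_id)
    qed
    moreover have "Min (dom X) \<in> dom X"
      using X by (intro Min_in) (auto simp: partial_vecs_def intro: finite_subset)
    then obtain y where "X (Min (dom X)) = Some y" by blast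
    moreover from this have "y < q"
      using X by (auto simp: partial_vecs_def ran_def)
    moreover from \<open>X (Min (dom X)) = Some y\<close> have "vrot q X (Min (dom X)) = Some (rot q y)"
      by (simp add: vrot_def)
    ultimately show ?thesis
      using False by (auto simp: lab_def)
  qed
  obtain xs where xs: "sorted_wrt map_le xs" "set xs \<subseteq> partial_vecs q n" "length xs = Suc n"
    "\<And>i. i < n \<Longrightarrow> lab (xs ! i) \<noteq> lab (xs ! Suc i)"
    using alternating_chain[of lab n] lab by blast
  have le: "xs ! i \<subseteq>\<^sub>m xs ! Suc i" if "i < n" for i
    using xs that by (simp add: sorted_wrt_iff_nth_less)
  have fd: "finite (dom (xs ! i))" if "i \<le> n" for i
    using xs that by (metis (no_types, lifting) finite_atMost finite_subset le_imp_less_Suc mem_Collect_eq nth_mem partial_vecs_def subsetD)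
  \<comment> \<open>Consecutive labels differ, so the vectors do, and each step of this chain of N
    vectors adds a coordinate; the last m + 1 of them are therefore large.\<close>
  have cd: "card (dom (xs ! i)) \<ge> Suc i" if "i \<le> n" for i
    using that
  proof (induction i)
    case 0
    have "xs ! 0 \<in> partial_vecs q n"
      using xs by (metis nth_mem subsetD zero_less_Suc)
    then show ?case
      using fd[of 0] by (simp add: partial_vecs_def Suc_le_eq card_gt_0_iff)
  next
    case (Suc i)
    have "xs ! i \<noteq> xs ! Suc i"
      using xs(4)[of i] Suc.prems by auto
    then have "dom (xs ! i) \<subset> dom (xs ! Suc i)"
      using le[of i] Suc.prems by (metis Suc_le_lessD map_le_antisym map_le_def map_le_implies_dom_le psubsetI)
    then have "card (dom (xs ! i)) < card (dom (xs ! Suc i))"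
      by (rule psubset_card_mono[OF fd[OF Suc.prems]])
    then show ?case
      using Suc.IH Suc.prems by linarith
  qed
  have large: "xs ! i \<in> lg" if "n - m \<le> i" "i \<le> n" for i
    using cd[OF that(2)] that xs N m by (auto simp: lg_def subset_iff)
  \<comment> \<open>The total size of the colour sets over one period is at most q t, but it drops
    at each of the last m steps, and m > q t.\<close>
  define \<Phi> where "\<Phi> X = (\<Sum>j<q. card (C ((vrot q ^^ j) X)))" for X
  have dec: "\<Phi> (xs ! Suc i) < \<Phi> (xs ! i)" if i: "n - m \<le> i" "i < n" for i
  proof -
    have "lab (xs ! i) \<noteq> lab (xs ! Suc i)"
      using xs(4) i by blast
    then have "\<tau> (xs ! i) \<noteq> \<tau> (xs ! Suc i)"
      using large[of i] large[of "Suc i"] i by (auto simp: lab_def)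
    then obtain j where "\<tau> (xs ! i) j \<noteq> \<tau> (xs ! Suc i) j"
      by blast
    moreover have "\<tau> X j = \<tau> X (j mod q)" for X
    proof -
      have id: "(vrot q ^^ (k * q)) X = X" for k
        by (induction k) (auto simp: funpow_add vrot_pow_id)
      have "(vrot q ^^ j) X = (vrot q ^^ (j mod q + j div q * q)) X" by simp
      also have "\<dots> = (vrot q ^^ (j mod q)) X"
        unfolding funpow_add using id by simp
      finally show ?thesis
        by (simp add: \<tau>_def)
    qed
    ultimately have j: "\<tau> (xs ! i) (j mod q) \<noteq> \<tau> (xs ! Suc i) (j mod q)"
      by metis
    have sub: "C ((vrot q ^^ j) (xs ! Suc i)) \<subseteq> C ((vrot q ^^ j) (xs ! i))" for j
      by (intro anti T_pow_mono le i)
    show ?thesis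
      unfolding \<Phi>_def
    proof (rule sum_strict_mono_ex1)
      show "\<exists>j\<in>{..<q}. card (C ((vrot q ^^ j) (xs ! Suc i))) < card (C ((vrot q ^^ j) (xs ! i)))"
        using j sub[of "j mod q"] q1
        by (intro bexI[of _ "j mod q"] psubset_card_mono fin) (auto simp: \<tau>_def)
    qed (auto intro!: card_mono fin sub)
  qed
  have "\<Phi> (xs ! (n - m + i)) + i \<le> q * t" if "i \<le> m" for i
    using that
  proof (induction i)
    case 0
    have "card (C X) \<le> t" for X
      using card_mono[OF _ fin(2)] by simp
    then show ?case
      using sum_mono[of "{..<q}" "\<lambda>j. card (C ((vrot q ^^ j) (xs ! (n - m))))" "\<lambda>_. t"]
      by (simp add: \<Phi>_def)
  next
    case (Suc i)
    have "n - m \<le> n - m + i" "n - m + i < n"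
      using Suc.prems N m by linarith+
    from dec[OF this] Suc show ?case
      by simp
  qed
  from this[of m] show False
    using m by simp
qed

section \<open>Exponential sums over powers\<close>

lemma cis_2pi_eq_1_iff: "cis (2 * pi * r) = 1 \<longleftrightarrow> r \<in> \<int>"
proof
  assume "cis (2 * pi * r) = 1"
  then have "cos (2 * pi * r) = 1"
    by (metis cis.simps(1) one_complex.simps(1))
  then obtain n :: int where "2 * pi * r = of_int n * 2 * pi"
    using cos_one_2pi_int by blast
  then show "r \<in> \<int>" by simp
qed (rule cis_multiple_2pi)

lemma sum_cis_eq_0:
  assumes "Q > 0" "\<not> int Q dvd j"
  shows "(\<Sum>d<Q. cis (2 * pi * (of_int j * real d / real Q))) = 0"
proof -
  let ?z = "cis (2 * pi * (of_int j / real Q))"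
  have "?z \<noteq> 1"
  proof
    assume "?z = 1"
    then obtain n :: int where "of_int j / real Q = of_int n"
      unfolding cis_2pi_eq_1_iff by (auto elim: Ints_cases)
    then have "real_of_int j = of_int (n * int Q)"
      using assms(1) by (simp add: field_simps)
    then have "j = n * int Q"
      by linarith
    then show False
      using assms(2) by simp
  qed
  moreover have "?z ^ Q = 1"
    using assms(1) cis_multiple_2pi[of "of_int j"] by (simp add: DeMoivre mult_ac)
  moreover have "(\<Sum>d<Q. cis (2 * pi * (of_int j * real d / real Q))) = (\<Sum>d<Q. ?z ^ d)"
    by (intro sum.cong) (auto simp: DeMoivre mult_ac)
  ultimately show ?thesis
    by (simp add: geometric_sum)
qed

lemma cmod_add_unit_squared:
  assumes "cmod x = 1"
  shows "(cmod (z + x))\<^sup>2 = (cmod z)\<^sup>2 + 1 + 2 * Re (z * cnj x)"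
proof -
  have "(Re x)\<^sup>2 + (Im x)\<^sup>2 = 1"
    using assms cmod_power2[of x] by simp
  then show ?thesis
    unfolding cmod_power2 by (simp add: power2_eq_square algebra_simps)
qed

text \<open>Averaging over all Q-th roots of unity kills the linear term and the square of the unit
  vector; the latter requires that Q does not divide 2, whence Q >= 3.\<close>

lemma roots_of_unity_moments:
  assumes Q: "Q \<ge> 3" and w: "cmod w = 1"
  defines "\<zeta> \<equiv> \<lambda>d. cis (2 * pi * (real d / real Q))"
  shows "(\<Sum>d<Q. (cmod (z + w * \<zeta> d))\<^sup>2) = real Q * ((cmod z)\<^sup>2 + 1)"
    and "(\<Sum>d<Q. (cmod (z + w * \<zeta> d)) ^ 4) = real Q * (((cmod z)\<^sup>2 + 1)\<^sup>2 + 2 * (cmod z)\<^sup>2)"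
proof -
  define y where "y d = z * cnj (w * \<zeta> d)" for d
  have sq: "(cmod (z + w * \<zeta> d))\<^sup>2 = (cmod z)\<^sup>2 + 1 + 2 * Re (y d)" for d
    unfolding y_def by (rule cmod_add_unit_squared) (simp add: norm_mult w \<zeta>_def)
  have s1: "(\<Sum>d<Q. \<zeta> d) = 0"
    using sum_cis_eq_0[of Q 1] Q by (simp add: \<zeta>_def)
  have "\<not> int Q dvd 2"
    using Q zdvd_imp_le[of "int Q" 2] by auto
  then have s2: "(\<Sum>d<Q. (\<zeta> d)\<^sup>2) = 0"
    using sum_cis_eq_0[of Q 2] Q by (simp add: \<zeta>_def DeMoivre mult_ac)
  have "(\<Sum>d<Q. y d) = z * cnj (w * (\<Sum>d<Q. \<zeta> d))"
    by (simp add: y_def sum_distrib_left)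
  then have "Re (\<Sum>d<Q. y d) = 0"
    by (simp add: s1)
  then have r1: "(\<Sum>d<Q. Re (y d)) = 0"
    by simp
  have "(\<Sum>d<Q. (y d)\<^sup>2) = z\<^sup>2 * cnj (w\<^sup>2 * (\<Sum>d<Q. (\<zeta> d)\<^sup>2))"
    by (simp add: y_def sum_distrib_left power_mult_distrib)
  then have "Re (\<Sum>d<Q. (y d)\<^sup>2) = 0"
    by (simp add: s2)
  then have "(\<Sum>d<Q. Re ((y d)\<^sup>2)) = 0"
    by simp
  moreover have "2 * (Re (y d))\<^sup>2 = (cmod z)\<^sup>2 + Re ((y d)\<^sup>2)" for d
  proof -
    have "cmod (y d) = cmod z"
      by (simp add: y_def norm_mult w \<zeta>_def)
    then show ?thesis
      using cmod_power2[of "y d"] by (simp add: power2_eq_square)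
  qed
  ultimately have "(\<Sum>d<Q. 2 * (Re (y d))\<^sup>2) = real Q * (cmod z)\<^sup>2"
    by (simp add: sum.distrib)
  then have r2: "2 * (\<Sum>d<Q. (Re (y d))\<^sup>2) = real Q * (cmod z)\<^sup>2"
    by (simp add: sum_distrib_left)
  show "(\<Sum>d<Q. (cmod (z + w * \<zeta> d))\<^sup>2) = real Q * ((cmod z)\<^sup>2 + 1)"
    unfolding sq by (simp add: sum.distrib r1 flip: sum_distrib_left)
  have "(cmod (z + w * \<zeta> d)) ^ 4
      = ((cmod z)\<^sup>2 + 1)\<^sup>2 + (4 * ((cmod z)\<^sup>2 + 1) * Re (y d) + 4 * (Re (y d))\<^sup>2)" for d
  proof -
    have "(cmod (z + w * \<zeta> d)) ^ 4 = ((cmod (z + w * \<zeta> d))\<^sup>2)\<^sup>2"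
      by simp
    also have "\<dots> = ((cmod z)\<^sup>2 + 1 + 2 * Re (y d))\<^sup>2"
      by (simp add: sq)
    finally show ?thesis
      by (simp add: power2_eq_square algebra_simps)
  qed
  then have "(\<Sum>d<Q. (cmod (z + w * \<zeta> d)) ^ 4)
      = real Q * ((cmod z)\<^sup>2 + 1)\<^sup>2 + 4 * ((cmod z)\<^sup>2 + 1) * (\<Sum>d<Q. Re (y d)) + 4 * (\<Sum>d<Q. (Re (y d))\<^sup>2)"
    by (simp add: sum.distrib sum_distrib_left)
  then show "(\<Sum>d<Q. (cmod (z + w * \<zeta> d)) ^ 4) = real Q * (((cmod z)\<^sup>2 + 1)\<^sup>2 + 2 * (cmod z)\<^sup>2)"
    using r2 by (simp add: r1 algebra_simps)
qed

text \<open>Modulo 1, the a-th phase is the base-Q fraction whose leading digit is digit a of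
  \<open>b\<close>, followed by the lower digits.\<close>

definition expsum :: "nat \<Rightarrow> nat \<Rightarrow> int \<Rightarrow> complex" where
  "expsum Q N b = (\<Sum>a<N. cis (2 * pi * (of_int b / real Q ^ Suc a)))"

lemma expsum_periodic:
  assumes "Q > 0"
  shows "expsum Q N (b + int (Q ^ N) * d) = expsum Q N b"
  unfolding expsum_def
proof (rule sum.cong)
  fix a assume "a \<in> {..<N}"
  then have "real Q ^ N = real Q ^ (N - Suc a) * real Q ^ Suc a"
    by (metis Suc_leI le_add_diff_inverse2 lessThan_iff power_add)
  then have "of_int (b + int (Q ^ N) * d) / real Q ^ Suc a
      = of_int b / real Q ^ Suc a + of_int (int (Q ^ (N - Suc a)) * d)"
    using assms by (simp add: add_divide_distrib)
  then have "cis (2 * pi * (of_int (b + int (Q ^ N) * d) / real Q ^ Suc a))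
    = cis (2 * pi * (of_int b / real Q ^ Suc a)) * cis (2 * pi * of_int (int (Q ^ (N - Suc a)) * d))"
    by (simp only: cis_mult distrib_left)
  then show "cis (2 * pi * (of_int (b + int (Q ^ N) * d) / real Q ^ Suc a))
    = cis (2 * pi * (of_int b / real Q ^ Suc a))"
    by (simp only: cis_multiple_2pi Ints_of_int mult_1_right)
qed simp

lemma sum_mixed_radix:
  fixes f :: "nat \<Rightarrow> real"
  shows "(\<Sum>b<Q * P. f b) = (\<Sum>b<P. \<Sum>d<Q. f (b + P * d))"
proof -
  have "(\<Sum>b<Q * P. f b) = (\<Sum>d<Q. sum f {d * P..<d * P + P})"
    by (rule sum.nat_group[symmetric])
  also have "\<dots> = (\<Sum>d<Q. \<Sum>b<P. f (b + P * d))"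
  proof (rule sum.cong)
    fix d
    show "sum f {d * P..<d * P + P} = (\<Sum>b<P. f (b + P * d))"
      using sum.shift_bounds_nat_ivl[of f 0 "d * P" P] by (simp add: lessThan_atLeast0 add.commute mult.commute)
  qed simp
  also have "\<dots> = (\<Sum>b<P. \<Sum>d<Q. f (b + P * d))"
    by (rule sum.swap)
  finally show ?thesis .
qed

text \<open>Induction over the top base-Q digit: it leaves the earlier terms alone and moves the new
  one uniformly through a rotated copy of the Q-th roots of unity. The means therefore evolve by m2
  + 1 and m4 + 4 m2 + 1.\<close>

lemma expsum_moments:
  assumes "Q \<ge> 3"
  shows "(\<Sum>b<Q ^ N. (cmod (expsum Q N (int b)))\<^sup>2) = real N * real Q ^ N"
    and "(\<Sum>b<Q ^ N. (cmod (expsum Q N (int b))) ^ 4) = (2 * (real N)\<^sup>2 - real N) * real Q ^ N"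
proof (induction N)
  case 0
  show "(\<Sum>b<Q ^ 0. (cmod (expsum Q 0 (int b)))\<^sup>2) = real 0 * real Q ^ 0"
    "(\<Sum>b<Q ^ 0. (cmod (expsum Q 0 (int b))) ^ 4) = (2 * (real 0)\<^sup>2 - real 0) * real Q ^ 0"
    by (simp_all add: expsum_def)
next
  case (Suc N)
  let ?P = "Q ^ N"
  have eq: "expsum Q (Suc N) (int (b + ?P * d))
    = expsum Q N (int b) + cis (2 * pi * (real b / real Q ^ Suc N)) * cis (2 * pi * (real d / real Q))" for b d
  proof -
    have "expsum Q N (int (b + ?P * d)) = expsum Q N (int b)"
      using expsum_periodic[of Q N "int b" "int d"] assms by simp
    moreover have "real_of_int (int (b + ?P * d)) / real Q ^ Suc N = real b / real Q ^ Suc N + real d / real Q"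
      using assms by (simp add: field_simps)
    moreover have "expsum Q (Suc N) c = expsum Q N c + cis (2 * pi * (of_int c / real Q ^ Suc N))" for c
      by (simp add: expsum_def)
    ultimately show ?thesis
      by (simp only: cis_mult distrib_left)
  qed
  have "(\<Sum>b<Q ^ Suc N. (cmod (expsum Q (Suc N) (int b)))\<^sup>2)
    = (\<Sum>b<?P. real Q * ((cmod (expsum Q N (int b)))\<^sup>2 + 1))"
    unfolding power_Suc sum_mixed_radix eq
    by (intro sum.cong roots_of_unity_moments(1)) (auto simp: assms)
  also have "\<dots> = real (Suc N) * real Q ^ Suc N"
    using Suc.IH(1) by (simp add: sum.distrib algebra_simps flip: sum_distrib_left)
  finally show "(\<Sum>b<Q ^ Suc N. (cmod (expsum Q (Suc N) (int b)))\<^sup>2) = real (Suc N) * real Q ^ Suc N" .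
  have "(\<Sum>b<Q ^ Suc N. (cmod (expsum Q (Suc N) (int b))) ^ 4)
    = (\<Sum>b<?P. real Q * (((cmod (expsum Q N (int b)))\<^sup>2 + 1)\<^sup>2 + 2 * (cmod (expsum Q N (int b)))\<^sup>2))"
    unfolding power_Suc sum_mixed_radix eq
    by (intro sum.cong roots_of_unity_moments(2)) (auto simp: assms)
  also have "\<dots> = (\<Sum>b<?P. real Q * ((cmod (expsum Q N (int b))) ^ 4 + 4 * (cmod (expsum Q N (int b)))\<^sup>2 + 1))"
    by (intro sum.cong) (auto simp: power2_eq_square power4_eq_xxxx algebra_simps)
  also have "\<dots> = real Q * ((2 * (real N)\<^sup>2 - real N) * real Q ^ N + 4 * (real N * real Q ^ N) + real Q ^ N)"
    using Suc.IH by (simp add: sum.distrib flip: sum_distrib_left)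
  also have "\<dots> = (2 * (real (Suc N))\<^sup>2 - real (Suc N)) * real Q ^ Suc N"
    by (simp add: power2_eq_square algebra_simps)
  finally show "(\<Sum>b<Q ^ Suc N. (cmod (expsum Q (Suc N) (int b))) ^ 4)
    = (2 * (real (Suc N))\<^sup>2 - real (Suc N)) * real Q ^ Suc N" .
qed

text \<open>A Paley-Zygmund argument: the minorant below has mean N^2 + N and the indicator carries
  the factor 4 N^2, which leaves a proportion of at least 1/4.\<close>

lemma expsum_annulus:
  assumes "Q \<ge> 3" "N > 0"
  shows "real (card {b\<in>{..<Q ^ N}. cmod (expsum Q N (int b)) \<in> {sqrt N / 2..2 * sqrt N}}) \<ge> real Q ^ N / 4"
proof -
  define F where "F b = cmod (expsum Q N (int b))" for b :: nat
  define A where "A = {b\<in>{..<Q ^ N}. F b \<in> {sqrt N / 2..2 * sqrt N}}"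
  \<comment> \<open>A quadratic polynomial in \<open>\<bar>F\<bar>\<^sup>2\<close> that minorizes the indicator function of the annulus
    and, by the fourth moment, has positive mean.\<close>
  have pt: "4 * F b ^ 2 * N - F b ^ 4 - (real N)\<^sup>2 \<le> 4 * (real N)\<^sup>2 * of_bool (b \<in> A)"
    if b: "b \<in> {..<Q ^ N}" for b
  proof -
    define x where "x = F b ^ 2"
    have x4: "F b ^ 4 = x\<^sup>2" by (simp add: x_def)
    have "4 * x * N - x\<^sup>2 - (real N)\<^sup>2 \<le> 4 * (real N)\<^sup>2 * of_bool (b \<in> A)"
    proof (cases "b \<in> A")
      case True
      have "4 * x * N - x\<^sup>2 - (real N)\<^sup>2 = 3 * (real N)\<^sup>2 - (x - 2 * N)\<^sup>2"
        by (simp add: power2_eq_square algebra_simps)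
      also have "\<dots> \<le> 4 * (real N)\<^sup>2"
        using zero_le_power2[of "x - 2 * N"] zero_le_power2[of "real N"] by linarith
      finally show ?thesis
        using True by simp
    next
      case False
      then consider "F b < sqrt N / 2" | "2 * sqrt N < F b"
        using b unfolding A_def by fastforce
      then have "4 * x * N - x\<^sup>2 - (real N)\<^sup>2 \<le> 0"
      proof cases
        case 1
        then have "x < (sqrt N / 2)\<^sup>2"
          unfolding x_def by (intro power_strict_mono) (auto simp: F_def)
        then have "4 * x \<le> N"
          by (simp add: power_divide)
        then have "4 * x * N \<le> real N * N"
          by (rule mult_right_mono) simp
        then show ?thesis
          using zero_le_power2[of x] unfolding power2_eq_square by linarith
      next
        case 2
        then have "(2 * sqrt N)\<^sup>2 < x"
          unfolding x_def using power_strict_mono[of "2 * sqrt N" "F b" 2] by simp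
        then have "4 * real N \<le> x"
          by (simp add: power_mult_distrib)
        moreover have "0 \<le> x"
          by (simp add: x_def)
        ultimately have "x * (4 * real N) \<le> x * x"
          by (rule mult_left_mono)
        then show ?thesis
          using zero_le_power2[of "real N"] unfolding power2_eq_square by argo
      qed
      then show ?thesis
        using False by simp
    qed
    then show ?thesis
      by (simp only: x4 x_def)
  qed
  have m2: "(\<Sum>b<Q ^ N. F b ^ 2) = real N * real Q ^ N"
    and m4: "(\<Sum>b<Q ^ N. F b ^ 4) = (2 * (real N)\<^sup>2 - real N) * real Q ^ N"
    unfolding F_def using expsum_moments[OF assms(1)] by auto
  have "(\<Sum>b<Q ^ N. 4 * F b ^ 2 * N - F b ^ 4 - (real N)\<^sup>2)
      \<le> (\<Sum>b<Q ^ N. 4 * (real N)\<^sup>2 * of_bool (b \<in> A))"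
    by (rule sum_mono) (fact pt)
  also have "\<dots> = 4 * (real N)\<^sup>2 * card A"
  proof -
    have "(\<Sum>b<Q ^ N. of_bool (b \<in> A)) = real (card ({..<Q ^ N} \<inter> A))"
      by (simp add: of_bool_def sum.If_cases)
    also have "{..<Q ^ N} \<inter> A = A"
      by (auto simp: A_def)
    finally show ?thesis
      by (simp only: sum_distrib_left[symmetric])
  qed
  also have "(\<Sum>b<Q ^ N. 4 * F b ^ 2 * N - F b ^ 4 - (real N)\<^sup>2)
      = 4 * (\<Sum>b<Q ^ N. F b ^ 2) * N - (\<Sum>b<Q ^ N. F b ^ 4) - (real N)\<^sup>2 * real Q ^ N"
    by (simp add: sum_subtractf sum_distrib_left sum_distrib_right)
  finally have le: "4 * (real N * real Q ^ N) * N - (2 * (real N)\<^sup>2 - real N) * real Q ^ N - (real N)\<^sup>2 * real Q ^ N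
      \<le> 4 * (real N)\<^sup>2 * card A"
    unfolding m2 m4 .
  have "4 * (real N * real Q ^ N) * N - (2 * (real N)\<^sup>2 - real N) * real Q ^ N - (real N)\<^sup>2 * real Q ^ N
    = (real N)\<^sup>2 * real Q ^ N + real N * real Q ^ N"
    by (simp add: power2_eq_square algebra_simps)
  moreover have "0 \<le> real N * real Q ^ N" by simp
  ultimately have "(real N)\<^sup>2 * real Q ^ N \<le> (real N)\<^sup>2 * (4 * card A)"
    using le by linarith
  then have "real Q ^ N \<le> 4 * real (card A)"
    using assms(2) by (subst (asm) mult_le_cancel_left_pos) auto
  then show ?thesis
    unfolding A_def F_def by linarith
qed

section \<open>A level set of the exponential sum with positive density\<close>

lemma same_floor_dist_less:
  fixes x y :: real
  assumes "\<lfloor>x\<rfloor> = \<lfloor>y\<rfloor>"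
  shows "\<bar>x - y\<bar> < 1"
  using assms floor_correct[of x] floor_correct[of y] by linarith

text \<open>Pigeonhole on squares of side sqrt N / K: one of them catches a fixed share of the
  annulus. Within it F varies by at most \<kappa> sqrt N / 4, while (w - 1) F has modulus at least
  \<kappa> sqrt N / 2.\<close>

lemma dense_level_set:
  fixes \<kappa> :: real
  assumes \<kappa>: "\<kappa> > 0"
  shows "\<exists>\<epsilon>>0. \<forall>Q N. Q \<ge> 3 \<longrightarrow> N > 0 \<longrightarrow> (\<exists>M :: int set.
    (\<forall>b d. b + int (Q ^ N) * d \<in> M \<longleftrightarrow> b \<in> M) \<and>
    real (card {b\<in>{..<Q ^ N}. int b \<in> M}) \<ge> \<epsilon> * real (Q ^ N) \<and>
    (\<forall>b\<in>M. \<forall>b'\<in>M. \<forall>w. \<kappa> \<le> cmod (w - 1) \<longrightarrow>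
      \<kappa> * sqrt N / 4 \<le> cmod (expsum Q N b - w * expsum Q N b')))"
proof -
  obtain K :: nat where K: "8 / \<kappa> < K"
    using reals_Archimedean2 by blast
  then have K0: "real K > 0"
    using \<kappa> by (meson divide_pos_pos less_trans zero_less_numeral)
  define I where "I = {- 2 * int K..2 * int K} \<times> {- 2 * int K..2 * int K}"
  have I: "finite I" "card I > 0" "I \<noteq> {}"
    by (auto simp: I_def card_gt_0_iff)
  \<comment> \<open>The annulus fills a quarter of a period, shared among \<open>card I\<close>
    squares; their number depends on \<kappa> only.\<close>
  define \<epsilon> where "\<epsilon> = 1 / (4 * real (card I))"
  show ?thesis
  proof (intro exI[of _ \<epsilon>] conjI allI impI)
    show "\<epsilon> > 0" using I by (simp add: \<epsilon>_def)
    fix Q N :: nat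
    assume QN: "Q \<ge> 3" "N > 0"
    define F where "F = expsum Q N"
    define h where "h b = (\<lfloor>K * Re (F b) / sqrt N\<rfloor>, \<lfloor>K * Im (F b) / sqrt N\<rfloor>)" for b
    define ann where "ann b \<longleftrightarrow> cmod (F b) \<in> {sqrt N / 2..2 * sqrt N}" for b
    have sN: "sqrt N > 0" using QN by simp
    have per: "F (b + int (Q ^ N) * d) = F b" for b d
      unfolding F_def using QN by (intro expsum_periodic) simp
    let ?A = "{b\<in>{..<Q ^ N}. ann (int b)}"
    let ?fib = "\<lambda>c. {b\<in>{..<Q ^ N}. ann (int b) \<and> h (int b) = c}"
    have "\<exists>c\<in>I. real (card (?fib c)) \<ge> \<epsilon> * real (Q ^ N)"
    proof (rule ccontr)
      assume "\<not> ?thesis"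
      then have less: "real (card (?fib c)) < \<epsilon> * real (Q ^ N)" if "c \<in> I" for c
        using that by force
      have floor_in: "\<lfloor>K * x / sqrt N\<rfloor> \<in> {- 2 * int K..2 * int K}" if "\<bar>x\<bar> \<le> 2 * sqrt N" for x :: real
      proof -
        have "\<bar>x\<bar> / sqrt N \<le> 2"
          using that sN by (simp add: divide_le_eq)
        then have "real K * (\<bar>x\<bar> / sqrt N) \<le> real K * 2"
          using K0 by (intro mult_left_mono) auto
        then have "\<bar>K * x / sqrt N\<bar> \<le> 2 * real K"
          using sN by (simp add: abs_mult)
        moreover have "\<lfloor>y\<rfloor> \<in> {- 2 * int K..2 * int K}" if "\<bar>y\<bar> \<le> 2 * real K" for y :: real
          using that unfolding atLeastAtMost_iff le_floor_iff floor_le_iff by (simp add: abs_le_iff)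
        ultimately show ?thesis by blast
      qed
      have "h (int b) \<in> I" if "b \<in> ?A" for b
      proof -
        have "cmod (F (int b)) \<le> 2 * sqrt N"
          using that by (simp add: ann_def)
        then have "\<bar>Re (F (int b))\<bar> \<le> 2 * sqrt N" "\<bar>Im (F (int b))\<bar> \<le> 2 * sqrt N"
          using abs_Re_le_cmod abs_Im_le_cmod order_trans by blast+
        then show ?thesis
          unfolding h_def I_def using floor_in by blast
      qed
      then have "?A \<subseteq> (\<Union>c\<in>I. ?fib c)"
        by auto
      then have "card ?A \<le> card (\<Union>c\<in>I. ?fib c)"
        using I by (intro card_mono) auto
      also have "\<dots> \<le> (\<Sum>c\<in>I. card (?fib c))"
        by (rule card_UN_le[OF I(1)])
      finally have "real (card ?A) \<le> (\<Sum>c\<in>I. real (card (?fib c)))"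
        by (simp flip: of_nat_sum)
      also have "\<dots> < real (card I) * (\<epsilon> * real (Q ^ N))"
        using less I by (intro sum_bounded_above_strict) auto
      also have "\<dots> = real Q ^ N / 4"
        using I by (simp add: \<epsilon>_def)
      finally have "real (card ?A) < real Q ^ N / 4" .
      moreover have "real Q ^ N / 4 \<le> real (card ?A)"
        unfolding ann_def F_def by (rule expsum_annulus[OF QN])
      ultimately show False by linarith
    qed
    then obtain c where c: "real (card (?fib c)) \<ge> \<epsilon> * real (Q ^ N)"
      by blast
    define M where "M = {b. ann b \<and> h b = c}"
    show "\<exists>M :: int set.
      (\<forall>b d. b + int (Q ^ N) * d \<in> M \<longleftrightarrow> b \<in> M) \<and>
      real (card {b\<in>{..<Q ^ N}. int b \<in> M}) \<ge> \<epsilon> * real (Q ^ N) \<and>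
      (\<forall>b\<in>M. \<forall>b'\<in>M. \<forall>w. \<kappa> \<le> cmod (w - 1) \<longrightarrow>
        \<kappa> * sqrt N / 4 \<le> cmod (expsum Q N b - w * expsum Q N b'))"
    proof (intro exI[of _ M] conjI allI ballI impI)
      show "b + int (Q ^ N) * d \<in> M \<longleftrightarrow> b \<in> M" for b d
        by (simp only: M_def ann_def h_def per mem_Collect_eq)
      show "real (card {b\<in>{..<Q ^ N}. int b \<in> M}) \<ge> \<epsilon> * real (Q ^ N)"
        using c by (simp add: M_def)
    next
      fix b b' w
      assume b: "b \<in> M" "b' \<in> M" and w: "\<kappa> \<le> cmod (w - 1)"
      have close: "\<bar>x - y\<bar> \<le> \<kappa> * sqrt N / 8" if "\<lfloor>K * x / sqrt N\<rfloor> = \<lfloor>K * y / sqrt N\<rfloor>" for x y :: real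
      proof -
        have "\<bar>K * x / sqrt N - K * y / sqrt N\<bar> < 1"
          using that by (rule same_floor_dist_less)
        also have "K * x / sqrt N - K * y / sqrt N = K * (x - y) / sqrt N"
          by (simp add: diff_divide_distrib right_diff_distrib)
        finally have "K * \<bar>x - y\<bar> < sqrt N"
          using sN by (simp add: abs_mult)
        moreover have "8 / \<kappa> * \<bar>x - y\<bar> \<le> K * \<bar>x - y\<bar>"
          using K by (intro mult_right_mono) auto
        ultimately have "8 / \<kappa> * \<bar>x - y\<bar> < sqrt N"
          by linarith
        then show ?thesis
          using \<kappa> by (simp add: field_simps)
      qed
      have "h b = h b'"
        using b by (simp add: M_def)
      then have "\<bar>Re (F b) - Re (F b')\<bar> \<le> \<kappa> * sqrt N / 8" "\<bar>Im (F b) - Im (F b')\<bar> \<le> \<kappa> * sqrt N / 8"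
        unfolding h_def prod.inject by (intro close; blast)+
      then have 1: "cmod (F b - F b') \<le> \<kappa> * sqrt N / 4"
        using cmod_le[of "F b - F b'"] unfolding minus_complex.simps by linarith
      have "\<kappa> * (sqrt N / 2) \<le> cmod (w - 1) * cmod (F b')"
        using w b \<kappa> by (intro mult_mono) (auto simp: M_def ann_def)
      also have "\<dots> = cmod ((F b - F b') - (F b - w * F b'))"
      proof -
        have "(F b - F b') - (F b - w * F b') = (w - 1) * F b'"
          by (simp add: algebra_simps)
        then show ?thesis by (simp only: norm_mult)
      qed
      also have "\<dots> \<le> cmod (F b - F b') + cmod (F b - w * F b')"
        by (rule norm_triangle_ineq4)
      finally show "\<kappa> * sqrt N / 4 \<le> cmod (expsum Q N b - w * expsum Q N b')"
        using 1 by (simp add: F_def)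
    qed
  qed
qed

section \<open>Integer codes of vectors and their action on the phases\<close>

lemma norm_cis_minus_1: "cmod (cis x - 1) \<le> \<bar>x\<bar>"
proof -
  have "(cmod (cis x - 1))\<^sup>2 = (cos x - 1)\<^sup>2 + (sin x)\<^sup>2"
    by (simp add: cmod_power2)
  also have "\<dots> = 2 - 2 * cos x"
    using sin_cos_squared_add[of x] by (simp add: power2_eq_square algebra_simps)
  also have "\<dots> = (2 * sin (x / 2))\<^sup>2"
    using cos_double_sin[of "x / 2"] by (simp add: power_mult_distrib)
  also have "\<dots> \<le> x\<^sup>2"
    using abs_sin_x_le_abs_x[of "x / 2"] by (intro abs_le_square_iff[THEN iffD1]) simp
  finally show ?thesis
    by (metis abs_le_square_iff abs_norm_cancel)
qed

text \<open>There are only finitely many nontrivial q-th roots of unity.\<close>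

lemma rotation_gap:
  assumes "q > 0"
  shows "\<exists>\<kappa>>0. \<forall>j. \<not> int q dvd j \<longrightarrow> \<kappa> \<le> cmod (cis (2 * pi * (of_int j / real q)) - 1)"
proof -
  define f where "f j = cmod (cis (2 * pi * (of_int j / real q)) - 1)" for j :: int
  have f0: "f j > 0" if "\<not> int q dvd j" for j
  proof -
    have "of_int j / real q \<notin> \<int>"
    proof
      assume "of_int j / real q \<in> \<int>"
      then obtain n :: int where "of_int j / real q = of_int n"
        by (auto elim: Ints_cases)
      then have "real_of_int j = of_int (n * int q)"
        using assms by (simp add: field_simps)
      then have "j = n * int q" by linarith
      then show False using that by simp
    qed
    then show ?thesis
      using cis_2pi_eq_1_iff[of "of_int j / real q"] by (simp add: f_def)
  qed
  have fm: "f j = f (j mod int q)" for j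
  proof -
    have "of_int j / real q = of_int (j mod int q) / real q + of_int (j div int q)"
    proof -
      have "real_of_int j = of_int (j mod int q) + of_int (j div int q) * real q"
        by (metis mod_div_mult_eq of_int_add of_int_mult of_int_of_nat_eq)
      then show ?thesis
        using assms by (simp add: field_simps)
    qed
    then have "cis (2 * pi * (of_int j / real q))
        = cis (2 * pi * (of_int (j mod int q) / real q)) * cis (2 * pi * of_int (j div int q))"
      by (simp only: cis_mult distrib_left)
    then show ?thesis
      unfolding f_def by (simp only: cis_multiple_2pi Ints_of_int mult_1_right)
  qed
  \<comment> \<open>The element 1 keeps the set nonempty when q = 1.\<close>
  define \<kappa> where "\<kappa> = Min (insert 1 (f ` {1..<int q}))"
  have "\<kappa> > 0"
    unfolding \<kappa>_def using f0 zdvd_not_zless by (subst Min_gr_iff) auto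
  moreover have "\<kappa> \<le> f j" if "\<not> int q dvd j" for j
  proof -
    have "j mod int q \<in> {1..<int q}"
    proof -
      have "0 \<le> j mod int q" "j mod int q < int q" "j mod int q \<noteq> 0"
        using that assms by (auto simp: dvd_eq_mod_eq_0)
      then show ?thesis
        unfolding atLeastLessThan_iff by linarith
    qed
    then show ?thesis
      unfolding \<kappa>_def fm[of j] by (intro Min_le) auto
  qed
  ultimately show ?thesis
    unfolding f_def by blast
qed

text \<open>With base-Q digits that are multiples of Q/q, adding 1 modulo q to the a-th entry turns
  the a-th phase by nearly 1/q.\<close>

definition embed :: "nat \<Rightarrow> nat \<Rightarrow> nat \<Rightarrow> (nat \<rightharpoonup> nat) \<Rightarrow> nat" where
  "embed q Q N Y = (\<Sum>a<N. the (Y a) * (Q div q) * Q ^ a)"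

lemma digits_less:
  fixes d :: "nat \<Rightarrow> nat"
  assumes "\<And>b. b < a \<Longrightarrow> d b < Q"
  shows "(\<Sum>b<a. d b * Q ^ b) < Q ^ a"
  using assms
proof (induction a)
  case (Suc a)
  then have "(\<Sum>b<a. d b * Q ^ b) < Q ^ a" "Suc (d a) \<le> Q"
    by (auto simp: Suc_le_eq)
  then have "(\<Sum>b<Suc a. d b * Q ^ b) < Suc (d a) * Q ^ a"
    by simp
  also have "\<dots> \<le> Q ^ Suc a"
    using \<open>Suc (d a) \<le> Q\<close> by (simp only: power_Suc) (rule mult_right_mono, auto)
  finally show ?case .
qed simp

text \<open>Higher digits contribute an integer, digit a an exact multiple of 1/q, and the lower
  digits at most 1/Q.\<close>

lemma embed_phase:
  assumes "q dvd Q" "Q > 0" "a < N" "Y \<in> total_vecs q N"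
  shows "\<exists>(z::int) r. 0 \<le> r \<and> r \<le> 1 / real Q \<and>
    real (embed q Q N Y) / real Q ^ Suc a = of_int z + real (the (Y a)) / real q + r"
proof -
  have q0: "q > 0" and Q: "q * (Q div q) = Q"
    using assms(1,2) by (auto intro: Nat.gr0I)
  then have Qq: "Q div q > 0"
    using assms(2) by (metis mult_0_right gr0I less_numeral_extra(3))
  define d where "d b = the (Y b) * (Q div q)" for b
  have dQ: "d b < Q" if "b < N" for b
  proof -
    have "b \<in> dom Y"
      using that assms(4) by (simp add: total_vecs_def)
    then obtain y where "Y b = Some y" by blast
    then have "the (Y b) < q"
      using assms(4) by (auto simp: total_vecs_def ran_def)
    then have "the (Y b) * (Q div q) < q * (Q div q)"
      using Qq by simp
    then show ?thesis
      by (simp add: Q d_def)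
  qed
  define lo where "lo = (\<Sum>b<a. d b * Q ^ b)"
  have "Q ^ Suc a dvd (\<Sum>b\<in>{Suc a..<N}. d b * Q ^ b)"
    by (intro dvd_sum dvd_mult le_imp_power_dvd) auto
  then obtain hi where hi: "(\<Sum>b\<in>{Suc a..<N}. d b * Q ^ b) = Q ^ Suc a * hi" ..
  have "{..<N} = {..<a} \<union> ({a} \<union> {Suc a..<N})"
    using assms(3) by auto
  then have "embed q Q N Y = (\<Sum>b\<in>{..<a} \<union> ({a} \<union> {Suc a..<N}). d b * Q ^ b)"
    by (simp add: embed_def d_def)
  also have "\<dots> = lo + (d a * Q ^ a + Q ^ Suc a * hi)"
    unfolding lo_def hi[symmetric] by (subst sum.union_disjoint, auto)+
  finally have e: "embed q Q N Y = lo + (d a * Q ^ a + Q ^ Suc a * hi)" .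
  have lo: "lo < Q ^ a"
    unfolding lo_def using dQ assms(3) by (intro digits_less) auto
  have QQ: "real q * real (Q div q) = real Q"
    by (metis Q of_nat_mult)
  have "real (embed q Q N Y) / real Q ^ Suc a
    = of_int (int hi) + real (d a) / real Q + real lo / real Q ^ Suc a"
    using assms(2) unfolding e by (simp add: field_simps)
  moreover have "real (d a) / real Q = real (the (Y a)) / real q"
    using Qq q0 by (simp add: d_def flip: QQ)
  moreover have "real lo / real Q ^ Suc a \<le> 1 / real Q"
  proof -
    have "real lo \<le> real Q ^ a"
      using lo by (metis less_imp_le of_nat_le_iff of_nat_power)
    then show ?thesis
      using assms(2) by (simp add: field_simps)
  qed
  ultimately show ?thesis
    by (intro exI[of _ "int hi"] exI[of _ "real lo / real Q ^ Suc a"]) auto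
qed

text \<open>Adding such a \<open>t\<close> multiplies the a-th term of \<open>expsum\<close> by
  nearly cis (2 pi / q).\<close>

definition phased :: "nat \<Rightarrow> nat \<Rightarrow> nat \<Rightarrow> int \<Rightarrow> bool" where
  "phased q Q a t \<longleftrightarrow> (\<exists>(z::int) r. \<bar>r\<bar> \<le> 1 / real Q \<and> of_int t / real Q ^ Suc a = of_int z + 1 / real q + r)"

text \<open>Both errors lie between 0 and 1/Q, so their difference is within 1/Q; the wrap-around at
  q - 1 affects the integer part only.\<close>

lemma embed_diff_phased:
  assumes "q dvd Q" "Q > 0" "a < N" "Y \<in> total_vecs q N" "Y' \<in> total_vecs q N" "Y' a = vrot q Y a"
  shows "phased q Q a (int (embed q Q N Y') - int (embed q Q N Y))"
proof -
  obtain z r where 1: "0 \<le> r" "r \<le> 1 / real Q"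
    "real (embed q Q N Y) / real Q ^ Suc a = of_int z + real (the (Y a)) / real q + r"
    using embed_phase[OF assms(1-4)] by blast
  obtain z' r' where 2: "0 \<le> r'" "r' \<le> 1 / real Q"
    "real (embed q Q N Y') / real Q ^ Suc a = of_int z' + real (the (Y' a)) / real q + r'"
    using embed_phase[OF assms(1-3,5)] by blast
  have q0: "q > 0" using assms(1,2) by (auto intro: Nat.gr0I)
  have "a \<in> dom Y"
    using assms(3,4) by (simp add: total_vecs_def)
  then obtain y where y: "Y a = Some y" by blast
  then have "y < q"
    using assms(4) by (auto simp: total_vecs_def ran_def)
  have "the (Y' a) = rot q y"
    using assms(6) y by (simp add: vrot_def)
  moreover have "\<exists>n::int. real (rot q y) / real q = real y / real q + 1 / real q + of_int n"
  proof (cases "Suc y < q")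
    case True
    then show ?thesis
      using \<open>y < q\<close> by (intro exI[of _ 0]) (simp add: rot_def add_divide_distrib)
  next
    case False
    then have "Suc y = q" using \<open>y < q\<close> by simp
    then have "rot q y = 0" "real y + 1 = real q"
      by (auto simp: rot_def)
    then show ?thesis
      using q0 by (intro exI[of _ "-1"]) (simp flip: add_divide_distrib)
  qed
  ultimately obtain n :: int where "real (the (Y' a)) / real q = real y / real q + 1 / real q + of_int n"
    by metis
  then have "of_int (int (embed q Q N Y') - int (embed q Q N Y)) / real Q ^ Suc a
     = of_int (z' - z + n) + 1 / real q + (r' - r)"
    using 1 2 y by (simp add: diff_divide_distrib)
  moreover have "\<bar>r' - r\<bar> \<le> 1 / real Q"
    using 1 2 by linarith
  ultimately show ?thesis
    unfolding phased_def by blast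
qed

text \<open>At most k m coordinates have an unphased step, and each costs 2; at the others the
  phases add up to the predicted rotation with error at most E/Q.\<close>

lemma expsum_shift:
  fixes e \<tau> :: "nat \<Rightarrow> int"
  assumes I: "finite I" "card I \<le> k"
    and \<tau>: "\<And>i. i \<in> I \<Longrightarrow> card {a\<in>{..<N}. \<not> phased q Q a (\<tau> i)} \<le> m"
    and E: "(\<Sum>i\<in>I. \<bar>e i\<bar>) \<le> int E"
  shows "cmod (expsum Q N (b + (\<Sum>i\<in>I. e i * \<tau> i))
     - cis (2 * pi * (of_int (\<Sum>i\<in>I. e i) / real q)) * expsum Q N b)
     \<le> 2 * real (k * m) + real N * (2 * pi * (real E / real Q))"
proof -
  define w where "w = (\<Sum>i\<in>I. e i * \<tau> i)"
  define j where "j = (\<Sum>i\<in>I. e i)"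
  define bad where "bad = (\<Union>i\<in>I. {a\<in>{..<N}. \<not> phased q Q a (\<tau> i)})"
  let ?d = "\<lambda>a. cis (2 * pi * (of_int w / real Q ^ Suc a)) - cis (2 * pi * (of_int j / real q))"
  have "card bad \<le> (\<Sum>i\<in>I. card {a\<in>{..<N}. \<not> phased q Q a (\<tau> i)})"
    unfolding bad_def by (rule card_UN_le[OF I(1)])
  also have "\<dots> \<le> card I * m"
    using sum_bounded_above[of I "\<lambda>i. card {a\<in>{..<N}. \<not> phased q Q a (\<tau> i)}" m] \<tau> by simp
  also have "\<dots> \<le> k * m"
    using I(2) by simp
  finally have bad: "card bad \<le> k * m" .
  have small: "cmod (?d a) \<le> 2 * pi * (real E / real Q)" if a: "a < N" "a \<notin> bad" for a
  proof -
    have "\<forall>i\<in>I. \<exists>(z::int) r. \<bar>r\<bar> \<le> 1 / real Q \<and> of_int (\<tau> i) / real Q ^ Suc a = of_int z + 1 / real q + r"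
      using a by (auto simp: bad_def phased_def)
    then obtain z r where zr: "\<And>i. i \<in> I \<Longrightarrow> \<bar>r i\<bar> \<le> 1 / real Q"
      "\<And>i. i \<in> I \<Longrightarrow> of_int (\<tau> i) / real Q ^ Suc a = of_int (z i) + 1 / real q + r i"
      by metis
    define R where "R = (\<Sum>i\<in>I. of_int (e i) * r i)"
    have "of_int w / real Q ^ Suc a = (\<Sum>i\<in>I. of_int (e i) * (of_int (\<tau> i) / real Q ^ Suc a))"
      by (simp add: w_def sum_divide_distrib)
    also have "\<dots> = (\<Sum>i\<in>I. of_int (e i) * (of_int (z i) + 1 / real q + r i))"
      by (intro sum.cong refl) (simp only: zr(2))
    also have "\<dots> = of_int (\<Sum>i\<in>I. e i * z i) + of_int j / real q + R"
      by (simp add: j_def R_def distrib_left sum.distrib sum_divide_distrib)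
    finally have "cis (2 * pi * (of_int w / real Q ^ Suc a))
      = cis (2 * pi * of_int (\<Sum>i\<in>I. e i * z i)) * cis (2 * pi * (of_int j / real q)) * cis (2 * pi * R)"
      by (simp only: cis_mult distrib_left)
    also have "\<dots> = cis (2 * pi * (of_int j / real q)) * cis (2 * pi * R)"
      by (simp only: cis_multiple_2pi Ints_of_int mult_1_left)
    finally have "?d a = cis (2 * pi * (of_int j / real q)) * (cis (2 * pi * R) - 1)"
      by (simp add: algebra_simps)
    then have "cmod (?d a) = cmod (cis (2 * pi * R) - 1)"
      by (simp add: norm_mult)
    also have "\<dots> \<le> 2 * pi * \<bar>R\<bar>"
      using norm_cis_minus_1[of "2 * pi * R"] by (simp add: abs_mult)
    also have "\<bar>R\<bar> \<le> (\<Sum>i\<in>I. \<bar>of_int (e i) * r i\<bar>)"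
      unfolding R_def by (rule sum_abs)
    also have "\<dots> \<le> (\<Sum>i\<in>I. \<bar>of_int (e i)\<bar> * (1 / real Q))"
      unfolding abs_mult by (intro sum_mono mult_left_mono zr(1)) auto
    also have "\<dots> = of_int (\<Sum>i\<in>I. \<bar>e i\<bar>) / real Q"
      by (simp add: sum_divide_distrib)
    also have "\<dots> \<le> real E / real Q"
      using E by (intro divide_right_mono) linarith+
    finally show ?thesis by simp
  qed
  have eq: "expsum Q N (b + w) - cis (2 * pi * (of_int j / real q)) * expsum Q N b
    = (\<Sum>a<N. cis (2 * pi * (of_int b / real Q ^ Suc a)) * ?d a)"
  proof -
    have "cis (2 * pi * (of_int (b + w) / real Q ^ Suc a))
      = cis (2 * pi * (of_int b / real Q ^ Suc a)) * cis (2 * pi * (of_int w / real Q ^ Suc a))" for a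
      by (simp only: cis_mult distrib_left of_int_add add_divide_distrib)
    then show ?thesis
      unfolding expsum_def by (simp add: sum_distrib_left right_diff_distrib sum_subtractf mult_ac)
  qed
  have "cmod (expsum Q N (b + w) - cis (2 * pi * (of_int j / real q)) * expsum Q N b)
      \<le> (\<Sum>a<N. cmod (?d a))"
    unfolding eq by (rule sum_norm_le) (simp add: norm_mult)
  also have "\<dots> \<le> (\<Sum>a<N. 2 * of_bool (a \<in> bad) + 2 * pi * (real E / real Q))"
  proof (rule sum_mono)
    fix a assume "a \<in> {..<N}"
    show "cmod (?d a) \<le> 2 * of_bool (a \<in> bad) + 2 * pi * (real E / real Q)"
    proof (cases "a \<in> bad")
      case True
      have "cmod (?d a) \<le> 2"
        using norm_triangle_ineq4[of "cis (2 * pi * (of_int w / real Q ^ Suc a))"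
            "cis (2 * pi * (of_int j / real q))"] unfolding norm_cis by linarith
      moreover have "0 \<le> 2 * pi * (real E / real Q)" by simp
      moreover have "of_bool (a \<in> bad) = (1 :: real)"
        using True by simp
      ultimately show ?thesis
        by linarith
    next
      case False
      then show ?thesis
        using small[of a] \<open>a \<in> {..<N}\<close> by simp
    qed
  qed
  also have "\<dots> = 2 * real (card bad) + real N * (2 * pi * (real E / real Q))"
  proof -
    have "(\<Sum>a<N. of_bool (a \<in> bad)) = real (card ({..<N} \<inter> bad))"
      by (simp add: of_bool_def sum.If_cases)
    also have "{..<N} \<inter> bad = bad"
      by (auto simp: bad_def)
    finally have "(\<Sum>a<N. of_bool (a \<in> bad)) = real (card bad)" .
    then show ?thesis
      by (simp add: sum.distrib flip: sum_distrib_left)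
  qed
  also have "\<dots> \<le> 2 * real (k * m) + real N * (2 * pi * (real E / real Q))"
    using bad by (intro add_right_mono mult_left_mono) (simp_all only: of_nat_le_iff)
  finally show ?thesis
    by (simp add: w_def j_def)
qed

section \<open>Dense sets avoiding combinations of steps\<close>

lemma finite_total_vecs: "finite (total_vecs q N)"
  unfolding total_vecs_def by (rule finite_set_of_finite_maps) auto

text \<open>\<open>M\<close> is the periodic set carrying the density, \<open>T\<close> the set of steps forcing \<open>t\<close> colours to be
  insufficient on \<open>V\<close>. The bound \<open>\<epsilon>\<close> has to be chosen before \<open>t\<close>.\<close>

locale gadget =
  fixes k E q :: nat and \<epsilon> :: real and t P :: nat and M :: "int set" and V :: "nat set" and T :: "int set"
  assumes P_pos: "P > 0"
    and finite_V: "finite V"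
    and T_diff: "T \<subseteq> (\<lambda>(u, v). int v - int u) ` (V \<times> V)"
    and M_periodic: "\<And>b d. b + int P * d \<in> M \<longleftrightarrow> b \<in> M"
    and M_dense: "real (card {b\<in>{..<P}. int b \<in> M}) \<ge> \<epsilon> * real P"
    and mono_edge: "\<And>f :: nat \<Rightarrow> nat. f ` V \<subseteq> {..<t} \<Longrightarrow> \<exists>u\<in>V. \<exists>v\<in>V. f u = f v \<and> int v - int u \<in> T"
    and M_avoid: "\<And>(I :: nat set) e \<tau> b. \<lbrakk>finite I; card I \<le> k; \<tau> ` I \<subseteq> T; (\<Sum>i\<in>I. \<bar>e i\<bar>) \<le> int E;
      \<not> int q dvd (\<Sum>i\<in>I. e i); b \<in> M\<rbrakk> \<Longrightarrow> b + (\<Sum>i\<in>I. e i * \<tau> i) \<notin> M"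

lemma gadget_exists:
  assumes q: "prime q"
  shows "\<exists>\<epsilon>>0. \<forall>t. \<exists>P M V T. gadget k E q \<epsilon> t P M V T"
proof -
  have q0: "q > 0" using q prime_gt_0_nat by blast
  obtain \<kappa> where \<kappa>: "\<kappa> > 0"
    "\<And>j. \<not> int q dvd j \<Longrightarrow> \<kappa> \<le> cmod (cis (2 * pi * (of_int j / real q)) - 1)"
    using rotation_gap[OF q0] by blast
  obtain \<epsilon> where \<epsilon>: "\<epsilon> > 0" "\<And>Q N. \<lbrakk>Q \<ge> 3; N > 0\<rbrakk> \<Longrightarrow> \<exists>M :: int set.
    (\<forall>b d. b + int (Q ^ N) * d \<in> M \<longleftrightarrow> b \<in> M) \<and>
    real (card {b\<in>{..<Q ^ N}. int b \<in> M}) \<ge> \<epsilon> * real (Q ^ N) \<and>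
    (\<forall>b\<in>M. \<forall>b'\<in>M. \<forall>w. \<kappa> \<le> cmod (w - 1) \<longrightarrow>
      \<kappa> * sqrt N / 4 \<le> cmod (expsum Q N b - w * expsum Q N b'))"
    using dense_level_set[OF \<kappa>(1)] by blast
  have "\<exists>P M V T. gadget k E q \<epsilon> t P M V T" for t
  proof -
    \<comment> \<open>The order of choice matters: m exceeds q t, then N outweighs the 2 k m lost to
      bad coordinates, and finally Q brings the remaining errors below 1.\<close>
    define m where "m = Suc (q * t)"
    define x where "x = 4 * (2 * real (k * m) + 1) / \<kappa>"
    obtain N0 :: nat where N0: "x\<^sup>2 < N0"
      using reals_Archimedean2 by blast
    define N where "N = Suc (N0 + m)"
    have mN: "q * t < m" "m < N" "N > 0" by (auto simp: m_def N_def)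
    have "x < sqrt N"
      using N0 by (intro real_less_rsqrt) (auto simp: N_def)
    then have gap: "2 * real (k * m) + 1 < \<kappa> * sqrt N / 4"
      using \<kappa>(1) by (simp add: x_def field_simps)
    \<comment> \<open>A multiple of q for the digits, at least 3 for the moments, and at least 8 N E
      to absorb 2 pi N E.\<close>
    define Q where "Q = q * (3 + 8 * N * E)"
    have Q: "q dvd Q" "Q \<ge> 3" "Q > 0"
    proof -
      show "q dvd Q" by (simp add: Q_def)
      have "1 * 3 \<le> q * (3 + 8 * N * E)"
        using q0 by (intro mult_le_mono) auto
      then show "Q \<ge> 3" by (simp add: Q_def)
      then show "Q > 0" by simp
    qed
    have err: "real N * (2 * pi * (real E / real Q)) \<le> 1"
    proof -
      have "1 * (8 * N * E) \<le> q * (3 + 8 * N * E)"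
        using q0 by (intro mult_le_mono) auto
      then have "real (1 * (8 * N * E)) \<le> real Q"
        unfolding Q_def by (simp only: of_nat_le_iff)
      then have 1: "8 * real N * real E \<le> real Q"
        by simp
      have "real N * real E * (2 * pi) \<le> real N * real E * 8"
        using pi_less_4 by (intro mult_left_mono) auto
      also have "\<dots> \<le> real Q"
        using 1 by simp
      finally show ?thesis
        using Q(3) by (simp add: field_simps)
    qed
    obtain M :: "int set" where M: "\<And>b d. b + int (Q ^ N) * d \<in> M \<longleftrightarrow> b \<in> M"
      "real (card {b\<in>{..<Q ^ N}. int b \<in> M}) \<ge> \<epsilon> * real (Q ^ N)"
      "\<And>b b' w. \<lbrakk>b \<in> M; b' \<in> M; \<kappa> \<le> cmod (w - 1)\<rbrakk> \<Longrightarrow>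
        \<kappa> * sqrt N / 4 \<le> cmod (expsum Q N b - w * expsum Q N b')"
      using \<epsilon>(2)[OF Q(2) mN(3)] by blast
    define g where "g = embed q Q N"
    define V where "V = g ` total_vecs q N"
    define T where "T = {int (g Y') - int (g Y) | Y Y'. Y \<in> total_vecs q N \<and> Y' \<in> total_vecs q N \<and>
      card {a\<in>{..<N}. Y' a \<noteq> vrot q Y a} \<le> m}"
    have T: "card {a\<in>{..<N}. \<not> phased q Q a s} \<le> m" if s: "s \<in> T" for s
    proof -
      obtain Y Y' where Y: "s = int (g Y') - int (g Y)" "Y \<in> total_vecs q N" "Y' \<in> total_vecs q N"
        "card {a\<in>{..<N}. Y' a \<noteq> vrot q Y a} \<le> m"
        using s unfolding T_def mem_Collect_eq by blast
      have "{a\<in>{..<N}. \<not> phased q Q a s} \<subseteq> {a\<in>{..<N}. Y' a \<noteq> vrot q Y a}"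
        using embed_diff_phased[OF Q(1,3) _ Y(2,3)] by (auto simp: Y(1) g_def)
      then have "card {a\<in>{..<N}. \<not> phased q Q a s} \<le> card {a\<in>{..<N}. Y' a \<noteq> vrot q Y a}"
        by (intro card_mono) auto
      then show ?thesis
        using Y(4) by linarith
    qed
    show ?thesis
    proof (rule exI[of _ "Q ^ N"], rule exI[of _ M], rule exI[of _ V], rule exI[of _ T], unfold_locales)
      show "Q ^ N > 0" using Q by simp
      show "finite V" by (simp add: V_def finite_total_vecs)
      show "T \<subseteq> (\<lambda>(u, v). int v - int u) ` (V \<times> V)"
      proof
        fix s assume "s \<in> T"
        then obtain Y Y' where "s = int (g Y') - int (g Y)" "Y \<in> total_vecs q N" "Y' \<in> total_vecs q N"
          unfolding T_def mem_Collect_eq by blast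
        then show "s \<in> (\<lambda>(u, v). int v - int u) ` (V \<times> V)"
          by (intro image_eqI[of _ _ "(g Y, g Y')"]) (auto simp: V_def)
      qed
      show "b + int (Q ^ N) * d \<in> M \<longleftrightarrow> b \<in> M" for b d by (rule M(1))
      show "real (card {b\<in>{..<Q ^ N}. int b \<in> M}) \<ge> \<epsilon> * real (Q ^ N)" by (rule M(2))
      show "\<exists>u\<in>V. \<exists>v\<in>V. f u = f v \<and> int v - int u \<in> T" if "f ` V \<subseteq> {..<t}" for f :: "nat \<Rightarrow> nat"
      proof -
        have "f (g Y) < t" if "Y \<in> total_vecs q N" for Y
          using \<open>f ` V \<subseteq> {..<t}\<close> that unfolding V_def by blast
        then obtain Y Y' where Y: "Y \<in> total_vecs q N" "Y' \<in> total_vecs q N"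
          "card {a\<in>{..<N}. Y' a \<noteq> vrot q Y a} \<le> m" "f (g Y) = f (g Y')"
          using shifted_kneser[OF q mN(1,2), of "\<lambda>Y. f (g Y)"] by blast
        then have "int (g Y') - int (g Y) \<in> T"
          unfolding T_def by blast
        then show ?thesis
          using Y unfolding V_def by blast
      qed
    next
      fix I :: "nat set" and e \<tau> b
      assume a: "finite I" "card I \<le> k" "\<tau> ` I \<subseteq> T" "(\<Sum>i\<in>I. \<bar>e i\<bar>) \<le> int E"
        "\<not> int q dvd (\<Sum>i\<in>I. e i)" "b \<in> M"
      show "b + (\<Sum>i\<in>I. e i * \<tau> i) \<notin> M"
      proof
        assume b: "b + (\<Sum>i\<in>I. e i * \<tau> i) \<in> M"
        let ?w = "cis (2 * pi * (of_int (\<Sum>i\<in>I. e i) / real q))"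
        have "\<kappa> * sqrt N / 4 \<le> cmod (expsum Q N (b + (\<Sum>i\<in>I. e i * \<tau> i)) - ?w * expsum Q N b)"
          by (rule M(3)[OF b a(6) \<kappa>(2)[OF a(5)]])
        also have "\<dots> \<le> 2 * real (k * m) + real N * (2 * pi * (real E / real Q))"
          using a T by (intro expsum_shift) auto
        finally show False
          using gap err by linarith
      qed
    qed
  qed
  with \<epsilon>(1) show ?thesis by blast
qed

section \<open>Solution-free sets\<close>

lemma abs_sum_mult_le:
  fixes c y :: "nat \<Rightarrow> int"
  assumes "\<And>i. i \<in> I \<Longrightarrow> \<bar>y i\<bar> \<le> H"
  shows "\<bar>\<Sum>i\<in>I. c i * y i\<bar> \<le> (\<Sum>i\<in>I. \<bar>c i\<bar>) * H"
proof -
  have "\<bar>\<Sum>i\<in>I. c i * y i\<bar> \<le> (\<Sum>i\<in>I. \<bar>c i * y i\<bar>)"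
    by (rule sum_abs)
  also have "\<dots> \<le> (\<Sum>i\<in>I. \<bar>c i\<bar> * H)"
    unfolding abs_mult using assms by (intro sum_mono mult_left_mono) auto
  finally show ?thesis
    by (simp only: sum_distrib_right)
qed

lemma not_dvd_if_abs_less:
  fixes a :: int
  assumes "a \<noteq> 0" "\<bar>a\<bar> < int q"
  shows "\<not> int q dvd a"
  using assms dvd_imp_le_int[of a "int q"] by auto

text \<open>The window sits at height 2 D H so that its contribution outweighs everything else
  unless its coefficients cancel; cancellation leaves at most two variables in it.\<close>

lemma no_integer_solution:
  fixes c y :: "nat \<Rightarrow> int" and L H D :: int
  assumes k: "k \<ge> 3"
    and c0: "\<And>i. i < k \<Longrightarrow> c i \<noteq> 0"
    and c3: "\<And>I. \<lbrakk>I \<subseteq> {..<k}; card I \<ge> 3\<rbrakk> \<Longrightarrow> (\<Sum>i\<in>I. c i) \<noteq> 0"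
    and D: "D = (\<Sum>i<k. \<bar>c i\<bar>)"
    and L: "L > 0" "\<And>i. i < k \<Longrightarrow> c i dvd L"
    and q: "\<bar>\<Sum>i<k. c i\<bar> * L < int q"
    and E: "int E = D * L"
    and M: "M \<noteq> {}"
    and key: "\<And>(I :: nat set) e \<tau> b. \<lbrakk>finite I; card I \<le> k; \<tau> ` I \<subseteq> T; (\<Sum>i\<in>I. \<bar>e i\<bar>) \<le> int E;
      \<not> int q dvd (\<Sum>i\<in>I. e i); b \<in> M\<rbrakk> \<Longrightarrow> b + (\<Sum>i\<in>I. e i * \<tau> i) \<notin> M"
    and H: "H > 0" "\<And>s. s \<in> T \<Longrightarrow> \<bar>L * s\<bar> \<le> H"
    and J: "J \<subseteq> {..<k}" "\<And>i. i \<in> J \<Longrightarrow> y i \<in> M \<and> 2 * D * H \<le> y i \<and> y i \<le> (2 * D + 1) * H"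
    and s: "\<And>i. i \<in> {..<k} - J \<Longrightarrow> s i \<in> T \<and> y i = L * s i"
  shows "(\<Sum>i<k. c i * y i) \<noteq> 0"
proof
  assume sol: "(\<Sum>i<k. c i * y i) = 0"
  define \<sigma> where "\<sigma> = (\<Sum>i<k. c i)"
  have \<sigma>: "\<sigma> \<noteq> 0"
    using c3[of "{..<k}"] k by (simp add: \<sigma>_def)
  have finJ: "finite J"
    using J(1) finite_subset by blast
  have "0 < \<bar>c 0\<bar>" "\<bar>c 0\<bar> \<le> D"
    using c0[of 0] k unfolding D by (auto intro: member_le_sum)
  then have D0: "D > 0" by linarith
  have split: "(\<Sum>i<k. f i) = (\<Sum>i\<in>J. f i) + (\<Sum>i\<in>{..<k} - J. f i)" for f :: "nat \<Rightarrow> int"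
    using sum.subset_diff[OF J(1), of f] by simp
  show False
  proof (cases "(\<Sum>i\<in>J. c i) = 0")
    case False
    \<comment> \<open>With the window shifted down by 2 D H, all variables have size at most H and
      contribute at most D H, against a main term of at least 2 D H.\<close>
    have "\<bar>\<Sum>i\<in>J. c i * (y i - 2 * D * H)\<bar> \<le> (\<Sum>i\<in>J. \<bar>c i\<bar>) * H"
      using J(2) by (intro abs_sum_mult_le) (force simp: algebra_simps)
    moreover have "\<bar>\<Sum>i\<in>{..<k} - J. c i * y i\<bar> \<le> (\<Sum>i\<in>{..<k} - J. \<bar>c i\<bar>) * H"
      using s H(2) by (intro abs_sum_mult_le) auto
    moreover have "(\<Sum>i\<in>J. c i * (y i - 2 * D * H)) = (\<Sum>i\<in>J. c i * y i) - (\<Sum>i\<in>J. c i) * (2 * D * H)"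
      by (simp add: right_diff_distrib sum_subtractf sum_distrib_right)
    moreover have "D * H = (\<Sum>i\<in>J. \<bar>c i\<bar>) * H + (\<Sum>i\<in>{..<k} - J. \<bar>c i\<bar>) * H"
      unfolding D split by (simp add: algebra_simps)
    ultimately have "\<bar>(\<Sum>i\<in>J. c i) * (2 * D * H)\<bar> \<le> D * H"
      using sol split[of "\<lambda>i. c i * y i"] by linarith
    moreover have "1 * (2 * D * H) \<le> \<bar>\<Sum>i\<in>J. c i\<bar> * (2 * D * H)"
      using False D0 H(1) by (intro mult_right_mono) auto
    moreover have "\<bar>(\<Sum>i\<in>J. c i) * (2 * D * H)\<bar> = \<bar>\<Sum>i\<in>J. c i\<bar> * (2 * D * H)"
      using D0 H(1) by (simp add: abs_mult)
    moreover have "D * H > 0"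
      using D0 H(1) by simp
    ultimately show False by linarith
  next
    case True
    then have "card J < 3"
      using c3[OF J(1)] by (meson not_less)
    then consider "card J = 0" | "card J = 1" | "card J = 2"
      by linarith
    then show False
    proof cases
      case 1
      \<comment> \<open>After division by L a combination of steps with coefficient sum \<sigma>
        vanishes; it would fix every point of \<open>M\<close>, which \<open>key\<close>
        forbids.\<close>
      then have J0: "J = {}" using finJ by simp
      have "L * (\<Sum>i<k. c i * s i) = (\<Sum>i<k. c i * y i)"
        unfolding sum_distrib_left using s J0 by (intro sum.cong) auto
      then have zero: "(\<Sum>i<k. c i * s i) = 0"
        using sol L(1) by simp
      obtain b where b: "b \<in> M" using M by blast
      have "D * 1 \<le> D * L"
        using D0 L(1) by (intro mult_left_mono) auto
      moreover have "\<not> int q dvd (\<Sum>i<k. c i)"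
      proof (rule not_dvd_if_abs_less)
        have "\<bar>\<sigma>\<bar> * 1 \<le> \<bar>\<sigma>\<bar> * L"
          using L(1) by (intro mult_left_mono) auto
        then show "\<bar>\<Sum>i<k. c i\<bar> < int q"
          using q by (simp add: \<sigma>_def)
      qed (use \<sigma> in \<open>simp add: \<sigma>_def\<close>)
      ultimately have "b + (\<Sum>i<k. c i * s i) \<notin> M"
        using b s J0 E D by (intro key) auto
      then show False
        using zero b by simp
    next
      case 2
      then obtain i where "J = {i}" by (auto simp: card_1_singleton_iff)
      then show False
        using True c0[of i] J(1) by simp
    next
      case 3
      then obtain i j where ij: "J = {i, j}" "i \<noteq> j"
        by (auto simp: card_2_iff)
      then have cj: "c j = - c i"
        using True by simp
      have ik: "i < k" using J(1) ij by simp
      \<comment> \<open>Dividing the equation by c_i writes y_i - y_j as a combination of steps with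
        coefficients -c_l h, whose sum -\<sigma> h is nonzero and below q in absolute value.\<close>
      obtain h where h: "L = c i * h"
        using L(2)[OF ik] by blast
      define e where "e l = - (c l * h)" for l
      have absh: "\<bar>h\<bar> \<le> L"
      proof -
        have "1 * \<bar>h\<bar> \<le> \<bar>c i\<bar> * \<bar>h\<bar>"
          using c0[OF ik] by (intro mult_right_mono) auto
        also have "\<dots> = L"
          using L(1) h by (simp flip: abs_mult)
        finally show ?thesis by simp
      qed
      have h0: "h \<noteq> 0" using h L(1) by auto
      have sI: "(\<Sum>l\<in>{..<k} - J. c l) = \<sigma>"
        using split[of c] True by (simp add: \<sigma>_def)
      have "(\<Sum>l\<in>{..<k} - J. c l * y l) = c i * (\<Sum>l\<in>{..<k} - J. c l * h * s l)"
        unfolding sum_distrib_left using s h by (intro sum.cong) auto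
      moreover have "(\<Sum>l\<in>J. c l * y l) = c i * (y i - y j)"
        using ij cj by (simp add: algebra_simps)
      ultimately have "c i * (y i - y j + (\<Sum>l\<in>{..<k} - J. c l * h * s l)) = 0"
        using sol split[of "\<lambda>i. c i * y i"] by (simp add: distrib_left)
      then have "y i - y j + (\<Sum>l\<in>{..<k} - J. c l * h * s l) = 0"
        using c0[OF ik] by simp
      moreover have "(\<Sum>l\<in>{..<k} - J. e l * s l) = - (\<Sum>l\<in>{..<k} - J. c l * h * s l)"
        by (simp add: e_def sum_negf)
      ultimately have yi: "y j + (\<Sum>l\<in>{..<k} - J. e l * s l) = y i"
        by linarith
      have "(\<Sum>l\<in>{..<k} - J. \<bar>e l\<bar>) = (\<Sum>l\<in>{..<k} - J. \<bar>c l\<bar>) * \<bar>h\<bar>"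
        by (simp add: e_def abs_mult sum_distrib_right)
      also have "\<dots> \<le> D * L"
        using absh unfolding D by (intro mult_mono sum_mono2 sum_nonneg) auto
      finally have "(\<Sum>l\<in>{..<k} - J. \<bar>e l\<bar>) \<le> int E"
        using E by simp
      moreover have "\<not> int q dvd (\<Sum>l\<in>{..<k} - J. e l)"
      proof (rule not_dvd_if_abs_less)
        have eq: "(\<Sum>l\<in>{..<k} - J. e l) = - (\<sigma> * h)"
          unfolding sI[symmetric] by (simp add: e_def sum_negf sum_distrib_right)
        then show "(\<Sum>l\<in>{..<k} - J. e l) \<noteq> 0"
          using \<sigma> h0 by simp
        have "\<bar>\<sigma>\<bar> * \<bar>h\<bar> \<le> \<bar>\<sigma>\<bar> * L"
          using absh by (intro mult_left_mono) auto
        then show "\<bar>\<Sum>l\<in>{..<k} - J. e l\<bar> < int q"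
          using q unfolding eq by (simp add: abs_mult \<sigma>_def)
      qed
      moreover have "card ({..<k} - J) \<le> k"
        using card_mono[of "{..<k}" "{..<k} - J"] by auto
      ultimately have "y j + (\<Sum>l\<in>{..<k} - J. e l * s l) \<notin> M"
        using s J(2)[of j] ij by (intro key) auto
      then show False
        using yi J(2)[of i] ij by simp
    qed
  qed
qed

section \<open>From integers to residues modulo p\<close>

lemma card_periodic_interval:
  fixes M :: "int set" and P :: nat
  assumes P: "P > 0" and per: "\<And>b d. b + int P * d \<in> M \<longleftrightarrow> b \<in> M"
  shows "card {b\<in>{a * P..<(a + n) * P}. int b \<in> M} \<ge> n * card {b\<in>{..<P}. int b \<in> M}"
proof -
  let ?R = "{b\<in>{..<P}. int b \<in> M}"
  let ?f = "\<lambda>(i, r). (a + i) * P + r"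
  have inj: "inj_on ?f ({..<n} \<times> ?R)"
  proof (rule inj_onI, clarsimp)
    fix i r i' r' assume *: "r < P" "r' < P" "(a + i) * P + r = (a + i') * P + r'"
    have "(x * P + r) div P = x" if "r < P" for x r
      using that by simp
    from this[OF *(1), of "a + i"] this[OF *(2), of "a + i'"] have "i = i'"
      unfolding *(3) by simp
    with *(3) show "i = i' \<and> r = r'" by simp
  qed
  have "n * card ?R = card (?f ` ({..<n} \<times> ?R))"
    using card_image[OF inj] by (simp add: card_cartesian_product)
  also have "\<dots> \<le> card {b\<in>{a * P..<(a + n) * P}. int b \<in> M}"
  proof (rule card_mono)
    show "?f ` ({..<n} \<times> ?R) \<subseteq> {b\<in>{a * P..<(a + n) * P}. int b \<in> M}"
    proof clarsimp
      fix i r assume *: "i < n" "r < P" "int r \<in> M"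
      have "(a + i) * P + r < (a + Suc i) * P"
        using *(2) by simp
      also have "\<dots> \<le> (a + n) * P"
        using *(1) by (intro mult_right_mono) auto
      finally have "(a + i) * P + r < (a + n) * P" .
      moreover have "int r + int P * int (a + i) \<in> M"
        using * per by blast
      then have "int ((a + i) * P + r) \<in> M"
        by (simp add: algebra_simps)
      ultimately show "a * P \<le> (a + i) * P + r \<and> (a + i) * P + r < (a + n) * P \<and>
          (int a + int i) * int P + int r \<in> M"
        by (simp add: algebra_simps)
    qed
  qed simp
  finally show ?thesis .
qed

text \<open>The identity is a proper colouring, so the \<open>LEAST\<close> is attained.\<close>

lemma cay_chromatic_colouring: "\<exists>f. proper_colouring p A (cay_chromatic p A) f"
proof -
  have "proper_colouring p A p id"
    by (simp add: proper_colouring_def cay_adj_def)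
  then have "\<exists>m f. proper_colouring p A m f"
    by blast
  then show ?thesis
    unfolding cay_chromatic_def by (rule LeastI_ex)
qed

theorem theorem5p1:
  fixes k :: nat and c :: "nat \<Rightarrow> int"
  assumes "k \<ge> 3"
    and "\<forall>i<k. c i \<noteq> 0"
    and "\<not> (\<exists>I. I \<subseteq> {0..<k} \<and> card I \<ge> 3 \<and> (\<Sum>i\<in>I. c i) = 0)"
  shows "\<exists>\<epsilon>::real. \<epsilon> > 0 \<and>
           (\<forall>t::nat. \<exists>P::nat. \<forall>p::nat. prime p \<and> p \<ge> P \<longrightarrow>
              (\<exists>A. A \<subseteq> {0..<p} \<and> solution_free k c p A \<and>
                   real (card A) \<ge> \<epsilon> * real p \<and> cay_chromatic p A \<ge> t))"
proof -
  have c0: "\<And>i. i < k \<Longrightarrow> c i \<noteq> 0"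
    using assms(2) by blast
  have c3: "\<And>I. \<lbrakk>I \<subseteq> {..<k}; card I \<ge> 3\<rbrakk> \<Longrightarrow> (\<Sum>i\<in>I. c i) \<noteq> 0"
    using assms(3) by (auto simp: lessThan_atLeast0)
  define D where "D = nat (\<Sum>i<k. \<bar>c i\<bar>)"
  have D: "int D = (\<Sum>i<k. \<bar>c i\<bar>)"
    by (simp add: D_def sum_nonneg)
  have "0 < \<bar>c 0\<bar>" "\<bar>c 0\<bar> \<le> (\<Sum>i<k. \<bar>c i\<bar>)"
    using c0[of 0] assms(1) by (auto intro: member_le_sum)
  then have D1: "D \<ge> 1" using D by linarith
  \<comment> \<open>Scaling the steps by a common multiple of the coefficients permits division by
    any single c_i.\<close>
  define L where "L = nat \<bar>\<Prod>i<k. c i\<bar>"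
  have Lc: "int L = \<bar>\<Prod>i<k. c i\<bar>"
    by (simp add: L_def)
  have L0: "L > 0"
    using c0 by (auto simp: L_def)
  have Ldvd: "c i dvd int L" if "i < k" for i
    unfolding Lc using that by (simp add: dvd_prodI)
  obtain q where q: "prime q" "nat (\<bar>\<Sum>i<k. c i\<bar> * int L) < q"
    using bigger_prime by blast
  then have q': "\<bar>\<Sum>i<k. c i\<bar> * int L < int q" by linarith
  obtain \<epsilon> where \<epsilon>: "\<epsilon> > 0" and gadget: "\<And>t. \<exists>P M V T. gadget k (D * L) q \<epsilon> t P M V T"
    using gadget_exists[OF q(1)] by blast
  have main: "\<exists>P0. \<forall>p. prime p \<and> p \<ge> P0 \<longrightarrow>
      (\<exists>A. A \<subseteq> {0..<p} \<and> solution_free k c p A \<and>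
        real (card A) \<ge> \<epsilon> / (8 * (real D)\<^sup>2) * real p \<and> cay_chromatic p A \<ge> t)" for t
  proof -
    obtain P M V T where G: "gadget k (D * L) q \<epsilon> t P M V T"
      using gadget by blast
    interpret gadget k "D * L" q \<epsilon> t P M V T
      by (fact G)
    obtain v0 where v0: "\<And>v. v \<in> V \<Longrightarrow> v \<le> v0"
      using finite_V unfolding finite_nat_set_iff_bounded_le by blast
    define s0 where "s0 = L * v0"
    have LV: "L * v \<le> s0" if "v \<in> V" for v
      using v0[OF that] by (simp add: s0_def)
    have LT: "\<bar>int L * s\<bar> \<le> int s0" if s: "s \<in> T" for s
    proof -
      obtain u v where uv: "u \<in> V" "v \<in> V" "s = int v - int u"
        using T_diff s by auto
      then have "int L * s = int (L * v) - int (L * u)"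
        by (simp add: right_diff_distrib)
      then show ?thesis
        using LV[OF uv(1)] LV[OF uv(2)] by linarith
    qed
    have "\<epsilon> * real P > 0"
      using \<epsilon> P_pos by simp
    then have "card {b\<in>{..<P}. int b \<in> M} > 0"
      using M_dense by linarith
    then have "{b\<in>{..<P}. int b \<in> M} \<noteq> {}"
      by (metis card.empty less_irrefl)
    then have M0: "M \<noteq> {}" by auto
    \<comment> \<open>A zero step would fix a point of \<open>M\<close>; hence the two ends of a
      monochromatic pair are distinct.\<close>
    have T0: "0 \<notin> T"
    proof
      assume "0 \<in> T"
      obtain b where b: "b \<in> M" using M0 by blast
      have "int 1 \<le> int (D * L)"
        using D1 L0 by (intro of_nat_mono) simp
      then have "b + (\<Sum>i\<in>{0::nat}. 1 * 0) \<notin> M"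
        using \<open>0 \<in> T\<close> b assms(1) prime_gt_1_nat[OF q(1)]
        by (intro M_avoid[of "{0}" "\<lambda>_. 0" "\<lambda>_. 1"]) auto
      then show False using b by simp
    qed
    show ?thesis
    proof (intro exI[of _ "4 * D\<^sup>2 * P * Suc s0"] allI impI)
      fix p assume p: "prime p \<and> p \<ge> 4 * D\<^sup>2 * P * Suc s0"
      \<comment> \<open>H = n P is the largest multiple of P with 4 D^2 H <= p, and the threshold on
        p gives n > s0.\<close>
      define n where "n = p div (4 * D\<^sup>2 * P)"
      define H where "H = n * P"
      have pos: "4 * D\<^sup>2 * P > 0"
        using D1 P_pos by simp
      have n: "Suc s0 \<le> n"
        using p pos by (simp add: n_def less_eq_div_iff_mult_less_eq mult_ac)
      have "n * 1 \<le> H"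
        unfolding H_def using P_pos by (intro mult_left_mono) auto
      then have H: "s0 < H" using n by simp
      have H4: "4 * D\<^sup>2 * H \<le> p"
        using div_times_less_eq_dividend[of p "4 * D\<^sup>2 * P"] by (simp add: n_def H_def mult_ac)
      have "D * (2 * D + 1) \<le> D * (3 * D)"
        using D1 by (intro mult_left_mono) auto
      then have "D * (2 * D + 1) * H \<le> 3 * D\<^sup>2 * H"
        by (intro mult_right_mono) (auto simp: power2_eq_square)
      moreover have "3 * D\<^sup>2 * H < 4 * D\<^sup>2 * H"
        using D1 H by simp
      ultimately have DH: "D * (2 * D + 1) * H < p"
        using H4 by linarith
      have "1 * ((2 * D + 1) * H) \<le> D * ((2 * D + 1) * H)"
        using D1 by (intro mult_right_mono) auto
      then have Hp: "(2 * D + 1) * H < p"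
        using DH by (simp only: mult_1_left mult.assoc)
      have "1 * H \<le> (2 * D + 1) * H"
        by (intro mult_right_mono) auto
      then have s0H: "s0 < (2 * D + 1) * H" and s0p: "s0 < p"
        using H Hp by linarith+
      \<comment> \<open>The window consists of n full periods of \<open>M\<close>.\<close>
      define B where "B = {b\<in>{2 * D * n * P..<(2 * D * n + n) * P}. int b \<in> M}"
      have B: "2 * D * H \<le> b" "b < (2 * D + 1) * H" "int b \<in> M" if "b \<in> B" for b
        using that by (auto simp: B_def H_def algebra_simps)
      define A where "A = B \<union> (\<lambda>s. nat (int L * s mod int p)) ` T"
      have p0: "p > 0" using s0p by simp
      have Ap: "A \<subseteq> {0..<p}"
      proof -
        have "nat (int L * s mod int p) < p" for s
          using p0 by (simp add: nat_less_iff)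
        moreover have "b < p" if "b \<in> B" for b
          using B(2)[OF that] Hp by simp
        ultimately show ?thesis by (auto simp: A_def)
      qed
      have free: "solution_free k c p A"
        unfolding solution_free_def
      proof (rule notI, elim exE conjE)
        fix x :: "nat \<Rightarrow> nat"
        assume xA: "\<forall>i<k. x i \<in> A" and x0: "(\<Sum>i<k. c i * int (x i)) mod int p = 0"
        define J where "J = {i\<in>{..<k}. x i \<in> B}"
        have "\<exists>s. \<forall>i\<in>{..<k} - J. s i \<in> T \<and> x i = nat (int L * s i mod int p)"
          using xA by (intro bchoice) (auto simp: J_def A_def)
        then obtain s where s: "\<And>i. i \<in> {..<k} - J \<Longrightarrow> s i \<in> T \<and> x i = nat (int L * s i mod int p)"
          by blast
        \<comment> \<open>Integer lifts: elements of \<open>B\<close> stand for themselves, the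
          others are replaced by L s, of size at most s0.\<close>
        define y where "y i = (if i \<in> J then int (x i) else int L * s i)" for i
        have "[y i = int (x i)] (mod int p)" if "i < k" for i
          using s[of i] that p0 by (auto simp: y_def cong_def)
        then have "[(\<Sum>i<k. c i * y i) = (\<Sum>i<k. c i * int (x i))] (mod int p)"
          by (intro cong_sum cong_scalar_left) auto
        then have dvd: "int p dvd (\<Sum>i<k. c i * y i)"
          using x0 by (simp add: cong_def dvd_eq_mod_eq_0)
        have "\<bar>y i\<bar> \<le> int ((2 * D + 1) * H)" if "i < k" for i
        proof (cases "i \<in> J")
          case True
          then have "x i \<in> B" by (simp add: J_def)
          then have "x i \<le> (2 * D + 1) * H" by (intro less_imp_le B)
          then have "int (x i) \<le> int ((2 * D + 1) * H)"
            by (simp only: of_nat_le_iff)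
          then show ?thesis
            using True by (simp only: y_def if_True abs_of_nat)
        next
          case False
          then have "\<bar>y i\<bar> \<le> int s0"
            using LT[of "s i"] s[of i] that by (simp add: y_def)
          also have "\<dots> \<le> int ((2 * D + 1) * H)"
            using s0H by (simp only: of_nat_le_iff)
          finally show ?thesis .
        qed
        \<comment> \<open>The lifted sum is a multiple of p of absolute value below p, hence
          zero.\<close>
        then have "\<bar>\<Sum>i<k. c i * y i\<bar> \<le> (\<Sum>i<k. \<bar>c i\<bar>) * int ((2 * D + 1) * H)"
          by (intro abs_sum_mult_le) auto
        also have "\<dots> = int (D * (2 * D + 1) * H)"
          by (simp add: D[symmetric] algebra_simps)
        also have "\<dots> < int p"
          using DH by (simp only: of_nat_less_iff)
        finally have "(\<Sum>i<k. c i * y i) = 0"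
          using dvd not_dvd_if_abs_less by blast
        moreover have "(\<Sum>i<k. c i * y i) \<noteq> 0"
        proof (rule no_integer_solution[where D = "int D" and L = "int L" and H = "int H" and E = "D * L"
              and J = J and s = s and q = q and M = M and T = T])
          show "\<bar>int L * s\<bar> \<le> int H" if "s \<in> T" for s
            using LT[OF that] H by linarith
          show "y i \<in> M \<and> 2 * int D * int H \<le> y i \<and> y i \<le> (2 * int D + 1) * int H" if "i \<in> J" for i
          proof -
            have xB: "x i \<in> B" using that by (simp add: J_def)
            have "int (2 * D * H) \<le> int (x i)" "int (x i) \<le> int ((2 * D + 1) * H)"
              using B(1,2)[OF xB] by linarith+
            then show ?thesis
              using B(3)[OF xB] that
              by (simp only: y_def if_True of_nat_mult of_nat_add of_nat_numeral of_nat_1 simp_thms)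
          qed
          show "s i \<in> T \<and> y i = int L * s i" if "i \<in> {..<k} - J" for i
            using s[OF that] that by (simp add: y_def)
        qed (use assms(1) c0 c3 D L0 Ldvd q' M0 M_avoid H in \<open>auto simp: J_def\<close>)
        ultimately show False by contradiction
      qed
      have card: "real (card A) \<ge> \<epsilon> / (8 * (real D)\<^sup>2) * real p"
      proof -
        have "finite A" using Ap finite_subset by blast
        then have "card B \<le> card A"
          by (intro card_mono) (auto simp: A_def)
        moreover have "n * card {b\<in>{..<P}. int b \<in> M} \<le> card B"
          unfolding B_def by (rule card_periodic_interval[OF P_pos M_periodic])
        ultimately have cA: "n * card {b\<in>{..<P}. int b \<in> M} \<le> card A"
          by linarith
        \<comment> \<open>Since n >= 1, rounding costs at most a factor 2, turning 4 D^2 into 8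
          D^2.\<close>
        have "p < (n + 1) * (4 * D\<^sup>2 * P)"
          using dividend_less_div_times[OF pos, of p] by (simp add: n_def algebra_simps)
        also have "\<dots> \<le> (2 * n) * (4 * D\<^sup>2 * P)"
          using n by (intro mult_right_mono) auto
        finally have "p \<le> n * P * (8 * D\<^sup>2)"
          by (simp add: mult_ac)
        then have "real p \<le> real (n * P * (8 * D\<^sup>2))"
          by (simp only: of_nat_le_iff)
        then have "real p / (8 * (real D)\<^sup>2) \<le> real n * real P"
          using D1 by (simp add: divide_le_eq)
        then have "\<epsilon> * (real p / (8 * (real D)\<^sup>2)) \<le> \<epsilon> * (real n * real P)"
          using \<epsilon> by (intro mult_left_mono) auto
        also have "\<dots> = real n * (\<epsilon> * real P)" by simp
        also have "\<dots> \<le> real n * real (card {b\<in>{..<P}. int b \<in> M})"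
          using M_dense by (intro mult_left_mono) auto
        also have "\<dots> \<le> real (card A)"
          using cA by (simp only: of_nat_le_iff flip: of_nat_mult)
        finally show ?thesis by simp
      qed
      have "cay_chromatic p A \<ge> t"
      proof (rule ccontr)
        assume "\<not> cay_chromatic p A \<ge> t"
        obtain f where f: "proper_colouring p A (cay_chromatic p A) f"
          using cay_chromatic_colouring by blast
        have Lp: "L * v < p" if "v \<in> V" for v
          using LV[OF that] s0p by simp
        \<comment> \<open>On the distinct vertices L v fewer than t colours would be used, so
          \<open>mono_edge\<close> yields a monochromatic arc with difference in L T.\<close>
        have "f (L * v) < t" if "v \<in> V" for v
          using f Lp[OF that] \<open>\<not> cay_chromatic p A \<ge> t\<close> unfolding proper_colouring_def
          by (meson less_trans not_less)
        then obtain u v where uv: "u \<in> V" "v \<in> V" "f (L * u) = f (L * v)" "int v - int u \<in> T"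
          using mono_edge[of "\<lambda>v. f (L * v)"] by (auto simp: image_subset_iff)
        have "u \<noteq> v" using uv(4) T0 by auto
        moreover have "nat ((int (L * v) - int (L * u)) mod int p) \<in> A"
        proof -
          have "int (L * v) - int (L * u) = int L * (int v - int u)"
            by (simp add: right_diff_distrib)
          then show ?thesis
            using uv(4) by (auto simp: A_def)
        qed
        ultimately have "cay_adj p A (L * u) (L * v)"
          using L0 by (simp add: cay_adj_def)
        then show False
          using f uv Lp unfolding proper_colouring_def by blast
      qed
      with Ap free card show "\<exists>A. A \<subseteq> {0..<p} \<and> solution_free k c p A \<and>
        real (card A) \<ge> \<epsilon> / (8 * (real D)\<^sup>2) * real p \<and> cay_chromatic p A \<ge> t"
        by blast
    qed
  qed
  moreover have "\<epsilon> / (8 * (real D)\<^sup>2) > 0"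
    using \<epsilon> D1 by simp
  ultimately show ?thesis by blast
qed

end
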